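(* Let $s(3,n)$ denote the number of combinatorial isomorphism types of simplicial $3$-spheres with exactly $n$ vertices. Then $s(3,n) = 2^{\Omega(n^{5/4})}$; that is, there exist a constant $c>0$ and an integer $N$ such that for every integer $n\ge N$ there are at least $2^{c\,n^{5/4}}$ pairwise combinatorially non-isomorphic simplicial $3$-spheres on $n$ vertices.
   Context: A simplicial $3$-sphere on $n$ vertices is a finite (abstract) simplicial complex with exactly $n$ vertices whose geometric realization is homeomorphic to the $3$-sphere $S^3$. (The number $s(d,n)$ is defined in general as the number of combinatorial types of simplicial PL $d$-spheres on $n$ vertices; in dimension $3$ every simplicial sphere is PL, so this condition is automatic.) Two simplicial spheres are combinatorially isomorphic (have the same combinatorial type) if there is a bijection between their vertex sets that maps faces to faces in both directions. Landau notation: for positive functions, $f=\Omega(g)$ means that there is a constant $c>0$ such that $f(n)\ge c\,g(n)$ for all sufficiently large $n$. *)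

theory Defs
  imports "HOL-Analysis.Analysis"
begin

(* Faces include the empty set: a nonempty K contains it by closure under subsets. *)
definition finite_simplicial_complex :: "'a set set \<Rightarrow> bool" where
  "finite_simplicial_complex K \<longleftrightarrow>
     finite K \<and> (\<forall>S\<in>K. finite S) \<and> (\<forall>S\<in>K. \<forall>T. T \<subseteq> S \<longrightarrow> T \<in> K)"

definition vertices :: "'a set set \<Rightarrow> 'a set" where
  "vertices K = \<Union>K"

(* Points are given by barycentric coordinates: nonnegative weights on the vertices, summing
   to 1, whose support is a face. The topology is that of the product space 'a \<Rightarrow> real, which
   for finite K is the usual topology on the realization. *)
definition geometric_realization :: "'a set set \<Rightarrow> ('a \<Rightarrow> real) set" where
  "geometric_realization K =
     {x. (\<forall>v. 0 \<le> x v) \<and> {v. x v \<noteq> 0} \<in> K \<and> (\<Sum>v\<in>{v. x v \<noteq> 0}. x v) = 1}"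

definition simplicial_3_sphere :: "'a set set \<Rightarrow> bool" where
  "simplicial_3_sphere K \<longleftrightarrow>
     finite_simplicial_complex K \<and>
     geometric_realization K homeomorphic (sphere 0 1 :: (real^4) set)"

definition combinatorially_isomorphic :: "'a set set \<Rightarrow> 'b set set \<Rightarrow> bool" where
  "combinatorially_isomorphic K L \<longleftrightarrow>
     (\<exists>f. bij_betw f (vertices K) (vertices L) \<and>
          (\<forall>S. S \<subseteq> vertices K \<longrightarrow> (S \<in> K \<longleftrightarrow> f ` S \<in> L)))"

(* Every simplicial 3-sphere with exactly n vertices is isomorphic to one with vertex set
   {..<n}, so the isomorphism types can be counted on this fixed vertex set. *)
definition labelled_3_spheres :: "nat \<Rightarrow> nat set set set" where
  "labelled_3_spheres n = {K. simplicial_3_sphere K \<and> vertices K = {..<n}}"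

definition same_type :: "nat \<Rightarrow> (nat set set \<times> nat set set) set" where
  "same_type n =
     {(K, L). K \<in> labelled_3_spheres n \<and> L \<in> labelled_3_spheres n \<and>
              combinatorially_isomorphic K L}"

definition num_3_spheres :: "nat \<Rightarrow> nat" where
  "num_3_spheres n = card (labelled_3_spheres n // same_type n)"

lemma finite_labelled_3_spheres: "finite (labelled_3_spheres n)"
proof (rule finite_subset)
  show "labelled_3_spheres n \<subseteq> Pow (Pow {..<n})"
    by (auto simp: labelled_3_spheres_def vertices_def)
qed simp

lemma combinatorially_isomorphic_refl: "combinatorially_isomorphic K K"
  unfolding combinatorially_isomorphic_def by (rule exI[of _ id]) auto

lemma combinatorially_isomorphic_sym:
  assumes "combinatorially_isomorphic K L"
  shows "combinatorially_isomorphic L K"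
proof -
  obtain f where f: "bij_betw f (vertices K) (vertices L)"
    and faces: "\<And>S. S \<subseteq> vertices K \<Longrightarrow> S \<in> K \<longleftrightarrow> f ` S \<in> L"
    using assms unfolding combinatorially_isomorphic_def by blast
  define g where "g = inv_into (vertices K) f"
  have g: "bij_betw g (vertices L) (vertices K)"
    unfolding g_def by (rule bij_betw_inv_into[OF f])
  have "T \<in> L \<longleftrightarrow> g ` T \<in> K" if T: "T \<subseteq> vertices L" for T
  proof -
    have "f ` g ` T = T"
      using T f unfolding g_def by (metis bij_betw_imp_surj_on image_inv_into_cancel)
    moreover have "g ` T \<subseteq> vertices K"
      using T g by (metis bij_betw_imp_surj_on image_mono)
    ultimately show ?thesis
      using faces by metis
  qed
  then show ?thesis
    unfolding combinatorially_isomorphic_def using g by blast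
qed

lemma combinatorially_isomorphic_trans:
  assumes "combinatorially_isomorphic K L" "combinatorially_isomorphic L M"
  shows "combinatorially_isomorphic K M"
proof -
  obtain f where f: "bij_betw f (vertices K) (vertices L)"
    and f_faces: "\<And>S. S \<subseteq> vertices K \<Longrightarrow> S \<in> K \<longleftrightarrow> f ` S \<in> L"
    using assms(1) unfolding combinatorially_isomorphic_def by blast
  obtain g where g: "bij_betw g (vertices L) (vertices M)"
    and g_faces: "\<And>S. S \<subseteq> vertices L \<Longrightarrow> S \<in> L \<longleftrightarrow> g ` S \<in> M"
    using assms(2) unfolding combinatorially_isomorphic_def by blast
  have "S \<in> K \<longleftrightarrow> (g \<circ> f) ` S \<in> M" if S: "S \<subseteq> vertices K" for S
  proof -
    have "f ` S \<subseteq> vertices L"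
      using S f by (metis bij_betw_imp_surj_on image_mono)
    then show ?thesis
      using f_faces[OF S] g_faces by (simp add: image_comp)
  qed
  then show ?thesis
    unfolding combinatorially_isomorphic_def using bij_betw_trans[OF f g] by blast
qed

lemma equiv_same_type: "equiv (labelled_3_spheres n) (same_type n)"
proof (rule equivI)
  show "same_type n \<subseteq> labelled_3_spheres n \<times> labelled_3_spheres n"
    by (auto simp: same_type_def)
  show "refl_on (labelled_3_spheres n) (same_type n)"
    by (auto simp: refl_on_def same_type_def combinatorially_isomorphic_refl)
  show "sym (same_type n)"
    by (auto simp: sym_def same_type_def intro: combinatorially_isomorphic_sym)
  show "trans (same_type n)"
    unfolding trans_def same_type_def by (auto intro: combinatorially_isomorphic_trans)
qed

end

theory Submission
  imports Defs "HOL-Real_Asymp.Real_Asymp"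
begin

text \<open>
  The join of a path on A 0, A 1, ... and a path on B 0, B 1, ... is a grid of tetrahedra
  {A i, A (i+1), B j, B (j+1)}: squares of the grid are tetrahedra, grid edges are triangles, and
  grid points are edges. The join of two cycles is a 3-sphere containing a large such grid. Cut out
  of the grid about n disjoint diagonal strips, replace each by the cone from a new vertex
  V k over its boundary, and for each of the order n^2 squares along one side of the strips choose freely
  whether it belongs to its strip. Every choice gives a 3-sphere, and different choices give
  different complexes on the same labelled vertex set. So there are at least 2^(c n^2) labelled
  spheres, and division by the at most n^n relabellings still leaves more than 2^(n^(5/4)) types.

  Enlarging the coned region by a single square is a bistellar flip. A flip exchanges
  s * boundary(t) for boundary(s) * t, and it preserves the homeomorphism type by an explicit
  formula in barycentric coordinates: move the weight min(x on s) from every vertex of s to the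
  vertices of t. The inverse is the same formula with s and t exchanged.
\<close>

subsection \<open>Bistellar flips and stellar subdivisions\<close>

lemma sum_support_eq:
  fixes x :: "'a \<Rightarrow> real"
  assumes "finite U" "{v. x v \<noteq> 0} \<subseteq> U"
  shows "sum x {v. x v \<noteq> 0} = sum x U"
  by (rule sum.mono_neutral_left) (use assms in auto)

lemma continuous_on_Min_coordinates:
  fixes s :: "'a set"
  assumes "finite s" "s \<noteq> {}"
  shows "continuous_on A (\<lambda>x::'a \<Rightarrow> real. Min (x ` s))"
  using assms
proof (induction s rule: finite_ne_induct)
  case (singleton v)
  then show ?case
    by (auto intro: continuous_on_subset[OF continuous_on_product_coordinates])
next
  case (insert v s)
  have "continuous_on A (\<lambda>x::'a \<Rightarrow> real. x v)"
    by (auto intro: continuous_on_subset[OF continuous_on_product_coordinates])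
  then have "continuous_on A (\<lambda>x::'a \<Rightarrow> real. min (x v) (Min (x ` s)))"
    using insert.IH by (rule continuous_on_min)
  then show ?case
    using insert by simp
qed

text \<open>The factor \<open>card s / card t\<close> makes the weight gained on \<open>t\<close>
  equal to the weight lost on \<open>s\<close>, so the total stays 1.\<close>

definition transfer_weight :: "'a set \<Rightarrow> 'a set \<Rightarrow> ('a \<Rightarrow> real) \<Rightarrow> 'a \<Rightarrow> real" where
  "transfer_weight s t x =
     (\<lambda>v. if v \<in> s then x v - Min (x ` s)
          else if v \<in> t then x v + Min (x ` s) * (card s / card t)
          else x v)"

lemma continuous_on_transfer_weight:
  assumes "finite s" "s \<noteq> {}"
  shows "continuous_on A (transfer_weight s t)"
proof (rule continuous_on_coordinatewise_then_product)
  fix v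
  have "continuous_on A (\<lambda>x::'a \<Rightarrow> real. x v)"
    by (auto intro: continuous_on_subset[OF continuous_on_product_coordinates])
  moreover have "continuous_on A (\<lambda>x::'a \<Rightarrow> real. Min (x ` s))"
    by (rule continuous_on_Min_coordinates[OF assms])
  ultimately show "continuous_on A (\<lambda>x. transfer_weight s t x v)"
    unfolding transfer_weight_def
    by (cases "v \<in> s"; cases "v \<in> t") (auto intro!: continuous_on_diff continuous_on_add
        continuous_on_mult_right simp del: times_divide_eq_right)
qed

text \<open>If the minimum over \<open>s\<close> is 0, the point is fixed and its support does not
  contain \<open>s\<close>, so \<open>away\<close> applies. Otherwise the support contains
  \<open>s\<close>, a vertex \<open>a\<close> attaining the minimum drops out, and
  \<open>star\<close> provides the new face.\<close>

lemma transfer_weight_in_realization: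
  assumes s: "finite s" "s \<noteq> {}" and t: "finite t" "t \<noteq> {}" and st: "s \<inter> t = {}"
    and fin: "\<And>S. S \<in> K \<Longrightarrow> finite S"
    and down: "\<And>S T. S \<in> K' \<Longrightarrow> T \<subseteq> S \<Longrightarrow> T \<in> K'"
    and away: "\<And>S. S \<in> K \<Longrightarrow> \<not> s \<subseteq> S \<Longrightarrow> S \<in> K'"
    and star: "\<And>S a. S \<in> K \<Longrightarrow> s \<subseteq> S \<Longrightarrow> a \<in> s \<Longrightarrow> (S - {a}) \<union> t \<in> K'"
    and x: "x \<in> geometric_realization K"
  shows "transfer_weight s t x \<in> geometric_realization K'"
proof -
  define c where "c = Min (x ` s)"
  define S where "S = {v. x v \<noteq> 0}"
  define y where "y = transfer_weight s t x"
  define U where "U = S \<union> s \<union> t"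
  have nonneg: "\<And>v. 0 \<le> x v" and S: "S \<in> K" and sum: "sum x S = 1"
    using x by (auto simp: geometric_realization_def S_def)
  have "c \<in> x ` s"
    unfolding c_def by (rule Min_in) (use s in auto)
  then obtain a where a: "a \<in> s" "x a = c" by blast
  have c_le: "c \<le> x v" if "v \<in> s" for v
    unfolding c_def by (rule Min_le) (use s that in auto)
  have c0: "c \<ge> 0" using a nonneg by metis
  have y: "y v = (if v \<in> s then x v - c else if v \<in> t then x v + c * (card s / card t) else x v)"
    for v by (simp add: y_def transfer_weight_def c_def)
  have fU: "finite U" using fin[OF S] s t by (simp add: U_def)
  have supp: "{v. y v \<noteq> 0} \<in> K'"
  proof (cases "c = 0")
    case True
    then have "y = x" by (auto simp: y)
    moreover have "\<not> s \<subseteq> S" using a True by (auto simp: S_def)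
    ultimately show ?thesis using away[OF S] by (simp add: S_def)
  next
    case False
    then have "c > 0" using c0 by simp
    then have "s \<subseteq> S" using c_le by (force simp: S_def)
    then have "(S - {a}) \<union> t \<in> K'" using star S a by blast
    moreover have "{v. y v \<noteq> 0} \<subseteq> (S - {a}) \<union> t"
      using a \<open>s \<subseteq> S\<close> by (auto simp: y S_def split: if_splits)
    ultimately show ?thesis using down by blast
  qed
  have y_alt: "y v = x v - (if v \<in> s then c else 0) + (if v \<in> t then c * (card s / card t) else 0)"
    for v using st by (auto simp: y)
  have "{v. y v \<noteq> 0} \<subseteq> U"
    by (auto simp: y U_def S_def split: if_splits)
  then have "sum y {v. y v \<noteq> 0} = sum y U" by (rule sum_support_eq[OF fU])
  also have "\<dots> = sum x U - (\<Sum>v\<in>U. if v \<in> s then c else 0)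
      + (\<Sum>v\<in>U. if v \<in> t then c * (card s / card t) else 0)"
    by (simp add: y_alt sum.distrib sum_subtractf)
  also have "(\<Sum>v\<in>U. if v \<in> s then c else 0) = card s * c"
  proof -
    have "U \<inter> s = s" by (auto simp: U_def)
    then show ?thesis using fU by (simp add: sum.If_cases)
  qed
  also have "(\<Sum>v\<in>U. if v \<in> t then c * (card s / card t) else 0) = card t * (c * (card s / card t))"
  proof -
    have "U \<inter> t = t" by (auto simp: U_def)
    then show ?thesis using fU by (simp add: sum.If_cases)
  qed
  also have "\<dots> = card s * c" using t by simp
  also have "sum x U = sum x S"
    unfolding S_def by (rule sum_support_eq[symmetric, OF fU]) (auto simp: U_def S_def)
  finally have "sum y {v. y v \<noteq> 0} = 1" using sum by simp
  moreover have "0 \<le> y v" for v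
    using nonneg c_le c0 by (simp add: y)
  ultimately show ?thesis using supp by (auto simp: geometric_realization_def y_def)
qed

text \<open>The support of \<open>x\<close> misses some \<open>b\<close> in \<open>t\<close>. After
  the transfer the minimum over \<open>t\<close> is attained at \<open>b\<close> and equals exactly
  the amount added, so the transfer back removes what was added.\<close>

lemma transfer_weight_inverse:
  assumes s: "finite s" "s \<noteq> {}" and t: "finite t" "t \<noteq> {}" and st: "s \<inter> t = {}"
    and no: "\<And>S. S \<in> K \<Longrightarrow> \<not> t \<subseteq> S"
    and x: "x \<in> geometric_realization K"
  shows "transfer_weight t s (transfer_weight s t x) = x"
proof -
  define d where "d = Min (x ` s) * (card s / card t)"
  have nonneg: "\<And>v. 0 \<le> x v" and S: "{v. x v \<noteq> 0} \<in> K"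
    using x by (auto simp: geometric_realization_def)
  from no[OF S] obtain b where b: "b \<in> t" "x b = 0" by auto
  have on_t: "transfer_weight s t x v = x v + d" if "v \<in> t" for v
    using that st by (auto simp: transfer_weight_def d_def)
  have "Min (transfer_weight s t x ` t) = d"
  proof (rule Min_eqI)
    show "finite (transfer_weight s t x ` t)" using t by simp
    show "d \<in> transfer_weight s t x ` t" using b on_t by force
    show "\<And>y. y \<in> transfer_weight s t x ` t \<Longrightarrow> d \<le> y" using on_t nonneg by auto
  qed
  moreover have "d * (card t / card s) = Min (x ` s)"
    using s t by (simp add: d_def)
  ultimately show ?thesis
    using st on_t by (auto simp: fun_eq_iff transfer_weight_def[of t s])
      (auto simp: transfer_weight_def)
qed

text \<open>The hypotheses are symmetric under exchanging \<open>s\<close>, \<open>K\<close> with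
  \<open>t\<close>, \<open>K'\<close>, so the two transfers are well defined, continuous and
  mutually inverse.\<close>

lemma homeomorphic_swap:
  assumes s: "finite s" "s \<noteq> {}" and t: "finite t" "t \<noteq> {}" and st: "s \<inter> t = {}"
    and K: "finite_simplicial_complex K" and K': "finite_simplicial_complex K'"
    and not_t: "\<And>S. S \<in> K \<Longrightarrow> \<not> t \<subseteq> S" and not_s: "\<And>S. S \<in> K' \<Longrightarrow> \<not> s \<subseteq> S"
    and away: "\<And>S. S \<in> K \<Longrightarrow> \<not> s \<subseteq> S \<Longrightarrow> S \<in> K'"
    and away': "\<And>S. S \<in> K' \<Longrightarrow> \<not> t \<subseteq> S \<Longrightarrow> S \<in> K"
    and star: "\<And>S a. S \<in> K \<Longrightarrow> s \<subseteq> S \<Longrightarrow> a \<in> s \<Longrightarrow> (S - {a}) \<union> t \<in> K'"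
    and star': "\<And>S a. S \<in> K' \<Longrightarrow> t \<subseteq> S \<Longrightarrow> a \<in> t \<Longrightarrow> (S - {a}) \<union> s \<in> K"
  shows "geometric_realization K homeomorphic geometric_realization K'"
proof -
  have ts: "t \<inter> s = {}" using st by blast
  have fin: "\<And>S. S \<in> K \<Longrightarrow> finite S" "\<And>S. S \<in> K' \<Longrightarrow> finite S"
    and down: "\<And>S T. S \<in> K \<Longrightarrow> T \<subseteq> S \<Longrightarrow> T \<in> K" "\<And>S T. S \<in> K' \<Longrightarrow> T \<subseteq> S \<Longrightarrow> T \<in> K'"
    using K K' unfolding finite_simplicial_complex_def by blast+
  show ?thesis
    unfolding homeomorphic_minimal
    using transfer_weight_in_realization[OF s t st fin(1) down(2) away star]
      transfer_weight_in_realization[OF t s ts fin(2) down(1) away' star']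
      transfer_weight_inverse[OF s t st not_t] transfer_weight_inverse[OF t s ts not_s]
      continuous_on_transfer_weight[OF s] continuous_on_transfer_weight[OF t]
    by (intro exI[of _ "transfer_weight s t"] exI[of _ "transfer_weight t s"] conjI ballI) simp_all
qed

section \<open>Complexes generated by finite families of facets\<close>

definition faces :: "'a set set \<Rightarrow> 'a set set" where
  "faces F = {S. \<exists>G\<in>F. S \<subseteq> G}"

definition facet_system :: "'a set set \<Rightarrow> bool" where
  "facet_system F \<longleftrightarrow> finite F \<and> (\<forall>G\<in>F. finite G)"

lemma finite_simplicial_complex_faces:
  assumes "facet_system F"
  shows "finite_simplicial_complex (faces F)"
proof -
  have "faces F = (\<Union>G\<in>F. Pow G)" by (auto simp: faces_def)
  then have "finite (faces F)" using assms by (auto simp: facet_system_def)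
  then show ?thesis
    using assms unfolding finite_simplicial_complex_def faces_def facet_system_def
    by (auto intro: finite_subset)
qed

text \<open>With a singleton \<open>t\<close> outside the complex this is a stellar subdivision of the face \<open>s\<close>.\<close>

lemma sphere_faces_subdivide:
  assumes F: "facet_system F" and sphere: "simplicial_3_sphere (faces F)"
    and s: "finite s" "s \<noteq> {}" and t: "finite t" "t \<noteq> {}" and st: "s \<inter> t = {}"
    and not: "\<And>G. G \<in> F \<Longrightarrow> \<not> t \<subseteq> G"
    and link: "\<And>G d. G \<in> F \<Longrightarrow> s \<subseteq> G \<Longrightarrow> d \<in> t \<Longrightarrow> (G \<union> t) - {d} \<in> F"
    and F': "F' = {G \<in> F. \<not> s \<subseteq> G} \<union> {(G - {a}) \<union> t | G a. G \<in> F \<and> s \<subseteq> G \<and> a \<in> s}"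
  shows "facet_system F' \<and> simplicial_3_sphere (faces F')"
proof -
  have "{(G - {a}) \<union> t | G a. G \<in> F \<and> s \<subseteq> G \<and> a \<in> s} \<subseteq> (\<lambda>(G, a). (G - {a}) \<union> t) ` (F \<times> s)"
    by auto
  then have "finite {(G - {a}) \<union> t | G a. G \<in> F \<and> s \<subseteq> G \<and> a \<in> s}"
    by (rule finite_subset) (use F s in \<open>auto simp: facet_system_def\<close>)
  then have sys: "facet_system F'"
    using F t unfolding facet_system_def F' by auto
  have "geometric_realization (faces F) homeomorphic geometric_realization (faces F')"
  proof (rule homeomorphic_swap[OF s t st])
    show "finite_simplicial_complex (faces F)" "finite_simplicial_complex (faces F')"
      using F sys by (auto intro: finite_simplicial_complex_faces)
    show "\<not> t \<subseteq> S" if "S \<in> faces F" for S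
      using that not by (auto simp: faces_def)
    show "\<not> s \<subseteq> S" if "S \<in> faces F'" for S
      using that st by (auto simp: faces_def F')
    show "(S - {a}) \<union> t \<in> faces F'" if S: "S \<in> faces F" "s \<subseteq> S" "a \<in> s" for S a
    proof -
      obtain G where "G \<in> F" "S \<subseteq> G" using S(1) unfolding faces_def by blast
      then have "(G - {a}) \<union> t \<in> F'" "(S - {a}) \<union> t \<subseteq> (G - {a}) \<union> t"
        using that unfolding F' by blast+
      then show ?thesis by (auto simp: faces_def)
    qed
    show "S \<in> faces F'" if S: "S \<in> faces F" "\<not> s \<subseteq> S" for S
    proof -
      obtain G a where G: "G \<in> F" "S \<subseteq> G" "a \<in> s" "a \<notin> S" using S unfolding faces_def by blast
      show ?thesis
      proof (cases "s \<subseteq> G")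
        case True
        then have "(G - {a}) \<union> t \<in> F'" "S \<subseteq> (G - {a}) \<union> t"
          using G unfolding F' by blast+
        then show ?thesis by (auto simp: faces_def)
      next
        case False
        then show ?thesis using G by (auto simp: faces_def F')
      qed
    qed
    \<comment> \<open>A facet of \<open>F'\<close> containing \<open>t\<close> must be new, of the
      form \<open>(G - {a}) \<union> t\<close>. By \<open>link\<close>,
      \<open>(G \<union> t) - {d}\<close> is an old facet, and it still contains all of
      \<open>s\<close>.\<close>
    have key: "\<exists>H\<in>F. S - {d} \<union> s \<subseteq> H" if S: "S \<in> faces F'" "t \<subseteq> S" "d \<in> t" for S d
    proof -
      obtain G' where G': "G' \<in> F'" "S \<subseteq> G'" using S(1) unfolding faces_def by blast
      then have "t \<subseteq> G'" using that by blast
      then have "G' \<notin> F" using not by blast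
      then obtain G a where G: "G \<in> F" "s \<subseteq> G" "G' = (G - {a}) \<union> t" using G' unfolding F' by blast
      have "(G \<union> t) - {d} \<in> F" using link G that by blast
      moreover have "S - {d} \<union> s \<subseteq> (G \<union> t) - {d}" using G G' that st by blast
      ultimately show ?thesis by blast
    qed
    show "(S - {a}) \<union> s \<in> faces F" if "S \<in> faces F'" "t \<subseteq> S" "a \<in> t" for S a
      using key[OF that] by (auto simp: faces_def)
    show "S \<in> faces F" if S: "S \<in> faces F'" "\<not> t \<subseteq> S" for S
    proof -
      obtain G' where G': "G' \<in> F'" "S \<subseteq> G'" using S(1) unfolding faces_def by blast
      obtain d where d: "d \<in> t" "d \<notin> S" using S by blast
      show ?thesis
      proof (cases "G' \<in> F")
        case True
        then show ?thesis using G' by (auto simp: faces_def)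
      next
        case False
        then obtain G a where G: "G \<in> F" "s \<subseteq> G" "G' = (G - {a}) \<union> t" using G' unfolding F' by blast
        have "(G \<union> t) - {d} \<in> F" using link G d by blast
        moreover have "S \<subseteq> (G \<union> t) - {d}" using G G' d by blast
        ultimately show ?thesis by (auto simp: faces_def)
      qed
    qed
  qed
  then have "simplicial_3_sphere (faces F')"
    using sphere finite_simplicial_complex_faces[OF sys] unfolding simplicial_3_sphere_def
    by (meson homeomorphic_sym homeomorphic_trans)
  then show ?thesis using sys by simp
qed

text \<open>The facets above \<open>s\<close> are exactly those of \<open>s\<close> joined with the
  boundary of \<open>t\<close>, because \<open>F1\<close> contributes none. Removing
  \<open>a\<close> in \<open>s\<close> and adding \<open>t\<close> turns each of them into
  \<open>(s \<union> t) - {a}\<close>, whichever vertex of \<open>t\<close> was missing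
  before.\<close>

lemma sphere_faces_flip:
  assumes F: "facet_system F" and sphere: "simplicial_3_sphere (faces F)"
    and s: "finite s" "s \<noteq> {}" and t: "finite t" "t \<noteq> {}" and st: "s \<inter> t = {}"
    and F_eq: "F = F1 \<union> (\<lambda>a. (s \<union> t) - {a}) ` t"
    and F1: "\<And>G. G \<in> F1 \<Longrightarrow> \<not> s \<subseteq> G \<and> \<not> t \<subseteq> G"
    and F'_eq: "F' = F1 \<union> (\<lambda>a. (s \<union> t) - {a}) ` s"
  shows "facet_system F' \<and> simplicial_3_sphere (faces F')"
proof (rule sphere_faces_subdivide[OF F sphere s t st])
  show "\<not> t \<subseteq> G" if "G \<in> F" for G
    using that F1 unfolding F_eq by blast
  show "(G \<union> t) - {d} \<in> F" if "G \<in> F" "s \<subseteq> G" "d \<in> t" for G d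
  proof -
    have "G \<union> t = s \<union> t" using that F1 unfolding F_eq by blast
    then show ?thesis using that unfolding F_eq by auto
  qed
  have "{(G - {a}) \<union> t | G a. G \<in> F \<and> s \<subseteq> G \<and> a \<in> s} = (\<lambda>a. (s \<union> t) - {a}) ` s"
  proof (intro equalityI subsetI)
    fix H assume "H \<in> {(G - {a}) \<union> t | G a. G \<in> F \<and> s \<subseteq> G \<and> a \<in> s}"
    then obtain G a where "H = (G - {a}) \<union> t" "G \<in> F" "s \<subseteq> G" "a \<in> s" by blast
    moreover from this obtain b where "G = (s \<union> t) - {b}" "b \<in> t" using F1 F_eq by blast
    ultimately have "H = (s \<union> t) - {a}" using st by blast
    then show "H \<in> (\<lambda>a. (s \<union> t) - {a}) ` s" using \<open>a \<in> s\<close> by blast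
  next
    fix H assume "H \<in> (\<lambda>a. (s \<union> t) - {a}) ` s"
    then obtain a where a: "a \<in> s" "H = (s \<union> t) - {a}" by blast
    obtain b where b: "b \<in> t" using t by blast
    have "(s \<union> t) - {b} \<in> F" "s \<subseteq> (s \<union> t) - {b}" "H = ((s \<union> t) - {b} - {a}) \<union> t"
      using a b st unfolding F_eq by auto
    then show "H \<in> {(G - {a}) \<union> t | G a. G \<in> F \<and> s \<subseteq> G \<and> a \<in> s}" using a by blast
  qed
  moreover have "{G \<in> F. \<not> s \<subseteq> G} = F1"
    using F1 st unfolding F_eq by auto
  ultimately show "F' = {G \<in> F. \<not> s \<subseteq> G} \<union> {(G - {a}) \<union> t | G a. G \<in> F \<and> s \<subseteq> G \<and> a \<in> s}"
    using F'_eq by simp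
qed

subsection \<open>The boundary of the simplex and joins of cycles\<close>

text \<open>Placing one vertex \<open>p\<close> at the origin and the other four at the standard
  basis vectors identifies the realization with the frontier of the standard simplex in 4-space.
  That simplex is compact, convex and has interior points, so its frontier is a 3-sphere.\<close>

lemma simplex_boundary_sphere:
  fixes X :: "'a set"
  assumes "card X = 5"
  shows "simplicial_3_sphere (faces ((\<lambda>a. X - {a}) ` X))"
proof -
  have X: "finite X" using assms by (intro card_ge_0_finite) simp
  then obtain p where p: "p \<in> X" using assms by fastforce
  have "card (X - {p}) = card (Basis :: (real^4) set)"
    using X p assms by simp
  then obtain e where e: "bij_betw e (Basis :: (real^4) set) (X - {p})"
    using X by (metis finite_Basis finite_Diff finite_same_card_bij)
  define r where "r = inv_into (Basis :: (real^4) set) e"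
  have er: "e (r v) = v" "r v \<in> Basis" if "v \<in> X" "v \<noteq> p" for v
    using that e unfolding r_def
    by (auto simp: bij_betw_inv_into_right bij_betw_def intro!: inv_into_into)
  have re: "r (e b) = b" "e b \<in> X" "e b \<noteq> p" if "b \<in> Basis" for b
    using that e unfolding r_def by (auto simp: bij_betw_def)
  define K where "K = faces ((\<lambda>a. X - {a}) ` X)"
  have K: "S \<in> K \<longleftrightarrow> S \<subset> X" for S
    unfolding K_def faces_def using p by auto
  define C where "C = convex hull (insert 0 (Basis :: (real^4) set))"
  have C: "convex C" "compact C"
    unfolding C_def by (auto intro!: finite_imp_compact_convex_hull)
  have Ceq: "C = {x. (\<forall>i\<in>Basis. 0 \<le> x\<bullet>i) \<and> sum (\<lambda>i. x\<bullet>i) Basis \<le> 1}"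
    unfolding C_def by (rule std_simplex)
  have Int: "interior C = {x. (\<forall>i\<in>Basis. 0 < x\<bullet>i) \<and> sum (\<lambda>i. x\<bullet>i) Basis < 1}"
    unfolding C_def by (rule interior_std_simplex)
  have "interior C \<noteq> {}"
    using interior_std_simplex_nonempty unfolding C_def by blast
  then have "frontier C homeomorphic frontier (cball (0::real^4) 1)"
    using C by (intro homeomorphic_frontiers homeomorphic_convex_compact)
      (auto simp: compact_imp_closed)
  then have fr: "frontier C homeomorphic sphere (0::real^4) 1" by simp
  have frC: "frontier C = C - interior C"
    using C by (simp add: frontier_def closure_closed compact_imp_closed)
  \<comment> \<open>\<open>h\<close> forgets the barycentric coordinate at \<open>p\<close>;
    \<open>k\<close> recovers it from the condition that the coordinates sum to 1.\<close>
  define h where "h x = (\<Sum>b\<in>Basis. x (e b) *\<^sub>R b)" for x :: "'a \<Rightarrow> real"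
  define k where "k y v = (if v = p then 1 - (\<Sum>b\<in>Basis. y \<bullet> b)
      else if v \<in> X then y \<bullet> r v else 0)" for y :: "real^4" and v
  have h_comp: "h x \<bullet> b = x (e b)" if "b \<in> Basis" for x b
    unfolding h_def using that by (simp add: inner_sum_left_Basis)
  have sum_e: "(\<Sum>b\<in>Basis. f (e b)) = sum f X - f p" for f :: "'a \<Rightarrow> real"
    using sum.reindex_bij_betw[OF e, of f] sum_diff1[OF X, of f p] p by simp
  have k_sum: "sum (k y) X = 1" for y
  proof -
    have "(\<Sum>b\<in>Basis. k y (e b)) = (\<Sum>b\<in>Basis. y \<bullet> b)"
      by (rule sum.cong) (auto simp: k_def re)
    then show ?thesis using sum_e[of "k y"] by (simp add: k_def)
  qed
  have supp: "{v. x v \<noteq> 0} \<subset> X" "sum x X = 1" "\<And>v. x v \<ge> 0" if "x \<in> geometric_realization K" for x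
    using that sum_support_eq[of X x] X by (auto simp: geometric_realization_def K)
  have "geometric_realization K homeomorphic frontier C"
    unfolding homeomorphic_minimal
  proof (intro exI[of _ h] exI[of _ k] conjI ballI)
    fix x assume x: "x \<in> geometric_realization K"
    note sx = supp[OF x]
    have sumh: "(\<Sum>b\<in>Basis. h x \<bullet> b) = 1 - x p"
      using sum_e[of x] sx by (simp add: h_comp)
    obtain u where u: "u \<in> X" "x u = 0" using sx by auto
    have "h x \<notin> interior C"
    proof
      assume "h x \<in> interior C"
      then have "\<And>b. b \<in> Basis \<Longrightarrow> 0 < x (e b)" "x p > 0"
        using sumh h_comp by (auto simp: Int)
      then show False using er[of u] u by (cases "u = p") force+
    qed
    moreover have "h x \<in> C"
      using sx sumh by (simp add: Ceq h_comp)
    ultimately show "h x \<in> frontier C" by (simp add: frC)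
    show "k (h x) = x"
    proof
      fix v
      have "v \<notin> X \<Longrightarrow> x v = 0" using sx by auto
      then show "k (h x) v = x v"
        using sumh er[of v] by (auto simp: k_def h_comp)
    qed
  next
    fix y assume "y \<in> frontier C"
    then have yC: "y \<in> C" "y \<notin> interior C" by (auto simp: frC)
    have y12: "\<forall>b\<in>Basis. 0 \<le> y \<bullet> b" "(\<Sum>b\<in>Basis. y \<bullet> b) \<le> 1"
      using yC(1) by (simp_all add: Ceq)
    moreover have "\<not> ((\<forall>b\<in>Basis. 0 < y \<bullet> b) \<and> (\<Sum>b\<in>Basis. y \<bullet> b) < 1)"
      using yC(2) unfolding Int by simp
    ultimately have y: "\<And>b. b \<in> Basis \<Longrightarrow> 0 \<le> y \<bullet> b" "(\<Sum>b\<in>Basis. y \<bullet> b) \<le> 1"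
      "(\<exists>b\<in>Basis. y \<bullet> b = 0) \<or> (\<Sum>b\<in>Basis. y \<bullet> b) = 1"
      by (auto simp: less_le)
    \<comment> \<open>A frontier point violates one of the strict inequalities describing the
      interior, so one barycentric coordinate vanishes and the support is a proper subset of
      \<open>X\<close>.\<close>
    have "\<exists>u\<in>X. k y u = 0"
      using y(3)
    proof
      assume "\<exists>b\<in>Basis. y \<bullet> b = 0"
      then obtain b where "b \<in> Basis" "y \<bullet> b = 0" by blast
      then show ?thesis using re[of b] by (intro bexI[of _ "e b"]) (auto simp: k_def)
    next
      assume "(\<Sum>b\<in>Basis. y \<bullet> b) = 1"
      then show ?thesis using p by (intro bexI[of _ p]) (auto simp: k_def)
    qed
    moreover have sub: "{v. k y v \<noteq> 0} \<subseteq> X" using p by (auto simp: k_def)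
    ultimately have "{v. k y v \<noteq> 0} \<in> K" by (auto simp: K)
    moreover have "sum (k y) {v. k y v \<noteq> 0} = 1"
      using sum_support_eq[OF X sub] k_sum by simp
    moreover have "0 \<le> k y v" for v using y er by (auto simp: k_def)
    ultimately show "k y \<in> geometric_realization K" by (simp add: geometric_realization_def)
    show "h (k y) = y"
      by (rule euclidean_eqI) (simp add: h_comp k_def re)
  next
    show "continuous_on (geometric_realization K) h"
      unfolding h_def
      by (auto intro!: continuous_intros continuous_on_subset[OF continuous_on_product_coordinates])
    show "continuous_on (frontier C) k"
    proof (rule continuous_on_coordinatewise_then_product)
      fix v show "continuous_on (frontier C) (\<lambda>y. k y v)"
        unfolding k_def by (cases "v = p"; cases "v \<in> X") (auto intro!: continuous_intros)
    qed
  qed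
  then have "geometric_realization K homeomorphic sphere (0::real^4) 1"
    using fr homeomorphic_trans by blast
  moreover have "finite_simplicial_complex K"
    unfolding K_def by (rule finite_simplicial_complex_faces) (use X in \<open>auto simp: facet_system_def\<close>)
  ultimately show ?thesis by (simp add: simplicial_3_sphere_def K_def)
qed

section \<open>Joins, and lengthening a cycle by subdividing an edge\<close>

definition is_sphere :: "'a set set \<Rightarrow> bool" where
  "is_sphere F \<longleftrightarrow> facet_system F \<and> simplicial_3_sphere (faces F)"

definition join :: "'a set set \<Rightarrow> 'a set set \<Rightarrow> 'a set set" where
  "join E H = {e \<union> h | e h. e \<in> E \<and> h \<in> H}"

lemma join_commute: "join E H = join H E"
  unfolding join_def by (auto simp: Un_commute)

lemma join_image: "join E H = (\<lambda>(e, h). e \<union> h) ` (E \<times> H)"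
  unfolding join_def by auto

lemma join_images: "join (f ` X) (g ` Y) = (\<lambda>(i, j). f i \<union> g j) ` (X \<times> Y)"
  unfolding join_image by force

lemma join_Un_left: "join (E \<union> E') H = join E H \<union> join E' H"
  by (simp add: join_image Sigma_Un_distrib1 image_Un)

lemma join_Un_right: "join E (H \<union> H') = join E H \<union> join E H'"
  by (simp add: join_image Sigma_Un_distrib2 image_Un)

text \<open>Write \<open>Q\<close> as \<open>H\<close> plus a vertex \<open>v\<close>. The join
  arises from the boundary of the 4-simplex on \<open>P \<union> H\<close> by subdividing the
  triangle \<open>P\<close> with new vertex \<open>v\<close>: the facets
  \<open>(P - {a}) \<union> H\<close> stay, and the two facets containing \<open>P\<close> supply
  those with \<open>v\<close>.\<close>

lemma is_sphere_join_simplex_boundaries: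
  assumes "card P = 3" "card Q = 3" "P \<inter> Q = {}"
  shows "is_sphere (join ((\<lambda>a. P - {a}) ` P) ((\<lambda>b. Q - {b}) ` Q))"
proof -
  have fin: "finite P" "finite Q" using assms by (auto intro: card_ge_0_finite)
  obtain v where v: "v \<in> Q" using assms by fastforce
  define H where "H = Q - {v}"
  have H: "Q = insert v H" "v \<notin> H" "v \<notin> P" "P \<inter> H = {}"
    using v assms by (auto simp: H_def)
  have "card H = 2" using v fin assms by (simp add: H_def)
  then have "card (P \<union> H) = 5"
    using assms fin H by (subst card_Un_disjoint) auto
  then have sphere: "simplicial_3_sphere (faces ((\<lambda>a. (P \<union> H) - {a}) ` (P \<union> H)))"
    by (rule simplex_boundary_sphere)
  have P0: "P \<noteq> {}" using assms by auto
  have 1: "{G \<in> (\<lambda>a. (P \<union> H) - {a}) ` (P \<union> H). \<not> P \<subseteq> G} = (\<lambda>a. (P - {a}) \<union> H) ` P"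
    using H by auto
  have 2: "{(G - {a}) \<union> {v} | G a. G \<in> (\<lambda>a. (P \<union> H) - {a}) ` (P \<union> H) \<and> P \<subseteq> G \<and> a \<in> P}
      = {(P - {a}) \<union> insert v (H - {b}) | a b. a \<in> P \<and> b \<in> H}" (is "?L = ?R")
  proof (intro equalityI subsetI)
    fix x assume "x \<in> ?L"
    then obtain a b where "a \<in> P" "b \<in> H" "x = (P \<union> H) - {b} - {a} \<union> {v}" by blast
    moreover from this have "x = (P - {a}) \<union> insert v (H - {b})" using H by blast
    ultimately show "x \<in> ?R" by blast
  next
    fix x assume "x \<in> ?R"
    then obtain a b where ab: "a \<in> P" "b \<in> H" "x = (P - {a}) \<union> insert v (H - {b})" by blast
    then have "x = ((P \<union> H) - {b} - {a}) \<union> {v}" "P \<subseteq> (P \<union> H) - {b}" using H by blast+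
    then show "x \<in> ?L" using ab by blast
  qed
  have 4: "join ((\<lambda>a. P - {a}) ` P) ((\<lambda>b. Q - {b}) ` Q)
      = (\<lambda>a. (P - {a}) \<union> H) ` P \<union> {(P - {a}) \<union> insert v (H - {b}) | a b. a \<in> P \<and> b \<in> H}"
  proof -
    have "(\<lambda>b. Q - {b}) ` Q = insert H ((\<lambda>b. insert v (H - {b})) ` H)"
      unfolding H(1) using H(2) by (auto simp: insert_Diff_if)
    moreover have "join (f ` P) (insert H (g ` H)) = (\<lambda>a. f a \<union> H) ` P \<union> {f a \<union> g b | a b. a \<in> P \<and> b \<in> H}"
      for f g :: "'a \<Rightarrow> 'a set"
      unfolding join_def by blast
    ultimately show ?thesis by simp
  qed
  have sys: "facet_system ((\<lambda>a. (P \<union> H) - {a}) ` (P \<union> H))"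
    using fin by (auto simp: facet_system_def H_def)
  have tv: "finite {v}" "{v} \<noteq> {}" by auto
  show ?thesis
    unfolding is_sphere_def
  proof (rule sphere_faces_subdivide[OF sys sphere fin(1) P0 tv])
    show "P \<inter> {v} = {}" "\<And>G. G \<in> (\<lambda>a. P \<union> H - {a}) ` (P \<union> H) \<Longrightarrow> \<not> {v} \<subseteq> G" using H by auto
    show "G \<union> {v} - {d} \<in> (\<lambda>a. P \<union> H - {a}) ` (P \<union> H)"
      if "G \<in> (\<lambda>a. P \<union> H - {a}) ` (P \<union> H)" "P \<subseteq> G" "d \<in> {v}" for G d
    proof -
      have "v \<notin> G" using that H by blast
      then have "G \<union> {v} - {d} = G" using that by auto
      then show ?thesis using that by simp
    qed
    show "join ((\<lambda>a. P - {a}) ` P) ((\<lambda>b. Q - {b}) ` Q)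
      = {G \<in> (\<lambda>a. P \<union> H - {a}) ` (P \<union> H). \<not> P \<subseteq> G} \<union>
        {G - {a} \<union> {v} |G a. G \<in> (\<lambda>a. P \<union> H - {a}) ` (P \<union> H) \<and> P \<subseteq> G \<and> a \<in> P}"
      by (simp only: 1 2 4)
  qed
qed

text \<open>\<open>n\<close> is the index of the last vertex: the cycle has \<open>n + 1\<close>
  vertices, and \<open>n = 2\<close> is a triangle. The closing edge stands apart because it is the
  one that gets subdivided and the one left out of the grid.\<close>

definition cycle_edges :: "(nat \<Rightarrow> 'a) \<Rightarrow> nat \<Rightarrow> 'a set set" where
  "cycle_edges f n = insert {f 0, f n} ((\<lambda>i. {f i, f (Suc i)}) ` {..<n})"

text \<open>Subdividing the closing edge \<open>{f 0, f n}\<close> by \<open>f (Suc n)\<close>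
  lengthens the cycle, and this is compatible with the join. For \<open>n \<ge> 2\<close> the
  closing edge differs from every path edge, so only the facets over it are subdivided.\<close>

lemma is_sphere_join_cycle_Suc:
  assumes sphere: "is_sphere (join (cycle_edges f n) H)" and n: "n \<ge> 2" and f: "inj f"
    and H: "\<And>h i. h \<in> H \<Longrightarrow> f i \<notin> h"
  shows "is_sphere (join (cycle_edges f (Suc n)) H)"
proof -
  have eq: "f i = f j \<longleftrightarrow> i = j" for i j using f by (auto simp: inj_def)
  define F where "F = join (cycle_edges f n) H"
  have F: "facet_system F" "simplicial_3_sphere (faces F)" using sphere by (auto simp: is_sphere_def F_def)
  have new: "f (Suc n) \<notin> G" if "G \<in> F" for G
    using that H unfolding F_def join_def cycle_edges_def by (auto simp: eq)
  define I where "I = (\<lambda>i. {f i, f (Suc i)}) ` {..<n}"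
  have split: "F = join I H \<union> join {{f 0, f n}} H"
    unfolding F_def join_def cycle_edges_def I_def by blast
  have sub: "\<not> {f 0, f n} \<subseteq> G" if G: "G \<in> join I H" for G
  proof -
    obtain i h where ih: "G = {f i, f (Suc i)} \<union> h" "h \<in> H" using G unfolding join_def I_def by blast
    then have "f 0 \<notin> h" "f n \<notin> h" using H by auto
    then show ?thesis using ih n by (auto simp: eq)
  qed
  have sup: "{f 0, f n} \<subseteq> G" if "G \<in> join {{f 0, f n}} H" for G
    using that unfolding join_def by blast
  have inner: "{G \<in> F. \<not> {f 0, f n} \<subseteq> G} = join I H"
    unfolding split using sub sup by blast
  have outer: "{G \<in> F. {f 0, f n} \<subseteq> G} = join {{f 0, f n}} H"
    unfolding split using sub sup by blast
  have "{(G - {a}) \<union> {f (Suc n)} | G a. G \<in> F \<and> {f 0, f n} \<subseteq> G \<and> a \<in> {f 0, f n}}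
     = {(G - {a}) \<union> {f (Suc n)} | G a. G \<in> {G \<in> F. {f 0, f n} \<subseteq> G} \<and> a \<in> {f 0, f n}}"
    by blast
  also have "\<dots> = {({f 0, f n} \<union> h - {a}) \<union> {f (Suc n)} | h a. h \<in> H \<and> a \<in> {f 0, f n}}"
    unfolding outer by (auto simp: join_def)
  also have "\<dots> = (\<lambda>h. ({f 0, f n} \<union> h - {f 0}) \<union> {f (Suc n)}) ` H \<union>
      (\<lambda>h. ({f 0, f n} \<union> h - {f n}) \<union> {f (Suc n)}) ` H"
    by blast
  also have "\<dots> = (\<lambda>h. {f n, f (Suc n)} \<union> h) ` H \<union> (\<lambda>h. {f 0, f (Suc n)} \<union> h) ` H"
  proof (rule arg_cong2[of _ _ _ _ "(\<union>)"]; rule image_cong)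
    fix h assume "h \<in> H"
    then have "f 0 \<notin> h" "f n \<notin> h" using H by auto
    then show "({f 0, f n} \<union> h - {f 0}) \<union> {f (Suc n)} = {f n, f (Suc n)} \<union> h"
      "({f 0, f n} \<union> h - {f n}) \<union> {f (Suc n)} = {f 0, f (Suc n)} \<union> h"
      using n eq by auto
  qed auto
  finally have star: "{(G - {a}) \<union> {f (Suc n)} | G a. G \<in> F \<and> {f 0, f n} \<subseteq> G \<and> a \<in> {f 0, f n}}
    = (\<lambda>h. {f n, f (Suc n)} \<union> h) ` H \<union> (\<lambda>h. {f 0, f (Suc n)} \<union> h) ` H" .
  have res: "join (cycle_edges f (Suc n)) H = join I H \<union>
     ((\<lambda>h. {f n, f (Suc n)} \<union> h) ` H \<union> (\<lambda>h. {f 0, f (Suc n)} \<union> h) ` H)"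
  proof -
    have "cycle_edges f (Suc n) = I \<union> {{f n, f (Suc n)}, {f 0, f (Suc n)}}"
      by (simp add: cycle_edges_def I_def lessThan_Suc insert_commute)
    moreover have "join (J \<union> {a, b}) H = join J H \<union> ((\<lambda>h. a \<union> h) ` H \<union> (\<lambda>h. b \<union> h) ` H)"
      for J :: "'a set set" and a b
      unfolding join_def by blast
    ultimately show ?thesis by simp
  qed
  show ?thesis
    unfolding is_sphere_def
  proof (rule sphere_faces_subdivide[OF F, where s = "{f 0, f n}" and t = "{f (Suc n)}"])
    show "G \<union> {f (Suc n)} - {d} \<in> F" if "G \<in> F" "{f 0, f n} \<subseteq> G" "d \<in> {f (Suc n)}" for G d
      using new[OF that(1)] that by (simp add: insert_Diff_if)
    show "join (cycle_edges f (Suc n)) H = {G \<in> F. \<not> {f 0, f n} \<subseteq> G} \<union>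
        {(G - {a}) \<union> {f (Suc n)} | G a. G \<in> F \<and> {f 0, f n} \<subseteq> G \<and> a \<in> {f 0, f n}}"
      by (simp only: star inner res)
  qed (use new in \<open>auto simp: eq\<close>)
qed

text \<open>Both cycles start as triangles, where the join is that of two simplex boundaries. They
  are then lengthened one after the other, with \<open>join_commute\<close> exchanging their
  roles.\<close>

lemma is_sphere_join_cycles:
  assumes f: "inj f" and g: "inj g" and fg: "\<And>i j. f i \<noteq> g j" and "m \<ge> 2" "n \<ge> 2"
  shows "is_sphere (join (cycle_edges f m) (cycle_edges g n))"
proof -
  have eq: "f i = f j \<longleftrightarrow> i = j" "g i = g j \<longleftrightarrow> i = j" for i j
    using f g by (auto simp: inj_def)
  have cyc: "cycle_edges h 2 = (\<lambda>a. {h 0, h 1, h 2} - {a}) ` {h 0, h 1, h (2::nat)}" if "inj h"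
    for h :: "nat \<Rightarrow> 'a"
  proof -
    have "h i = h j \<longleftrightarrow> i = j" for i j using that by (auto simp: inj_def)
    then show ?thesis
      by (auto simp: cycle_edges_def numeral_2_eq_2 lessThan_Suc insert_Diff_if)
  qed
  have base: "is_sphere (join (cycle_edges f 2) (cycle_edges g 2))"
    unfolding cyc[OF f] cyc[OF g]
    by (rule is_sphere_join_simplex_boundaries) (use fg in \<open>auto simp: eq dest: sym\<close>)
  have disj: "g i \<notin> h" if "h \<in> cycle_edges f k" for h i k
    using that fg[symmetric] by (auto simp: cycle_edges_def)
  have disj': "f i \<notin> h" if "h \<in> cycle_edges g k" for h i k
    using that fg by (auto simp: cycle_edges_def)
  from \<open>m \<ge> 2\<close> have "is_sphere (join (cycle_edges f m) (cycle_edges g 2))"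
  proof (induction m rule: dec_induct)
    case (step m)
    then show ?case by (intro is_sphere_join_cycle_Suc f disj')
  qed (rule base)
  then have start: "is_sphere (join (cycle_edges g 2) (cycle_edges f m))" by (simp add: join_commute)
  from \<open>n \<ge> 2\<close> have "is_sphere (join (cycle_edges g n) (cycle_edges f m))"
  proof (induction n rule: dec_induct)
    case (step n)
    then show ?case by (intro is_sphere_join_cycle_Suc g disj)
  qed (rule start)
  then show ?thesis by (simp add: join_commute)
qed

subsection \<open>Flips in a grid of tetrahedra\<close>

datatype vertex = A nat | B nat | V nat

definition tet :: "nat \<Rightarrow> nat \<Rightarrow> vertex set" where
  "tet i j = {A i, A (Suc i), B j, B (Suc j)}"

text \<open>The triangle between the squares \<open>(i, j)\<close> and \<open>(Suc i, j)\<close>, followed by the one between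
  \<open>(i, j)\<close> and \<open>(i, Suc j)\<close>. The triangles at the outer sides of row 0 and column 0 are missing, so
  the regions used later stay away from row and column 0.\<close>

definition vertical_triangle :: "nat \<Rightarrow> nat \<Rightarrow> vertex set" where
  "vertical_triangle i j = {A (Suc i), B j, B (Suc j)}"

definition horizontal_triangle :: "nat \<Rightarrow> nat \<Rightarrow> vertex set" where
  "horizontal_triangle i j = {A i, A (Suc i), B (Suc j)}"

definition vertical_boundary :: "(nat \<times> nat) set \<Rightarrow> (nat \<times> nat) set" where
  "vertical_boundary R = {(i, j). ((i, j) \<in> R) \<noteq> ((Suc i, j) \<in> R)}"

definition horizontal_boundary :: "(nat \<times> nat) set \<Rightarrow> (nat \<times> nat) set" where
  "horizontal_boundary R = {(i, j). ((i, j) \<in> R) \<noteq> ((i, Suc j) \<in> R)}"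

text \<open>The two families of walls are separate arguments so that the few walls affected by a
  flip can be split off with \<open>cone_over_Un\<close>.\<close>

definition cone_over :: "vertex \<Rightarrow> (nat \<times> nat) set \<Rightarrow> (nat \<times> nat) set \<Rightarrow> vertex set set" where
  "cone_over v E H = (\<lambda>(i, j). insert v (vertical_triangle i j)) ` E \<union> (\<lambda>(i, j). insert v (horizontal_triangle i j)) ` H"

abbreviation boundary_cone :: "vertex \<Rightarrow> (nat \<times> nat) set \<Rightarrow> vertex set set" where
  "boundary_cone v R \<equiv> cone_over v (vertical_boundary R) (horizontal_boundary R)"

lemma cone_over_Un:
  "cone_over v (E \<union> E') (H \<union> H') = cone_over v E H \<union> cone_over v E' H'"
  by (auto simp: cone_over_def)

text \<open>A facet outside the strip avoids the interior of the region \<open>R\<close>: it touches the grid only on its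
  boundary, or inside a single square that does not belong to \<open>R\<close>.\<close>

definition avoids :: "nat \<Rightarrow> nat \<Rightarrow> (nat \<times> nat) set \<Rightarrow> vertex set \<Rightarrow> bool" where
  "avoids p q R G \<longleftrightarrow>
     (\<forall>i j. A i \<in> G \<longrightarrow> B j \<in> G \<longrightarrow> \<not> (0 < i \<and> i < p \<and> 0 < j \<and> j < q)) \<or>
     (\<exists>x y. (x, y) \<notin> R \<and> (\<forall>i. A i \<in> G \<longrightarrow> i = x \<or> i = Suc x) \<and> (\<forall>j. B j \<in> G \<longrightarrow> j = y \<or> j = Suc y))"

lemma avoids_mono: "avoids p q R G \<Longrightarrow> R' \<subseteq> R \<Longrightarrow> avoids p q R' G"
  unfolding avoids_def by blast

text \<open>Containing \<open>s\<close> would give \<open>G\<close> an interior grid point, which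
  rules out the first alternative of \<open>avoids\<close>. The second would put \<open>s\<close>
  into a square outside \<open>R\<close>, while the last assumption puts every square around
  \<open>s\<close> into \<open>R\<close>.\<close>

lemma not_subset_if_avoids:
  assumes "avoids p q R G" "A i \<in> s" "B j \<in> s" "0 < i" "i < p" "0 < j" "j < q"
    and "\<And>x y. \<forall>i. A i \<in> s \<longrightarrow> i = x \<or> i = Suc x \<Longrightarrow> \<forall>j. B j \<in> s \<longrightarrow> j = y \<or> j = Suc y \<Longrightarrow> (x, y) \<in> R"
  shows "\<not> s \<subseteq> G"
  using assms unfolding avoids_def by (meson subsetD)

text \<open>The four alternatives for the square \<open>(Suc i, Suc j)\<close> are the situations in which adding it to
  the coned region is a flip: an initial 1-4 move, two kinds of 2-3 moves (only the left or only the
  bottom neighbour is present), and a 3-2 move around the bottom right grid point.\<close>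

definition addable :: "(nat \<times> nat) set \<Rightarrow> nat \<Rightarrow> nat \<Rightarrow> bool" where
  "addable R i j \<longleftrightarrow>
     R = {} \<or>
     (i, Suc j) \<in> R \<and> (\<forall>y. (Suc i, y) \<notin> R \<and> (Suc (Suc i), y) \<notin> R) \<or>
     (Suc i, j) \<in> R \<and> (\<forall>x. (x, Suc j) \<notin> R \<and> (x, Suc (Suc j)) \<notin> R) \<or>
     (Suc i, j) \<in> R \<and> (Suc (Suc i), j) \<in> R \<and> (Suc (Suc i), Suc j) \<in> R \<and>
       (i, Suc j) \<notin> R \<and> (i, Suc (Suc j)) \<notin> R \<and> (Suc i, Suc (Suc j)) \<notin> R"

lemma is_sphere_flip:
  assumes "is_sphere (F1 \<union> (\<lambda>a. (s \<union> t) - {a}) ` t)"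
    and "finite s" "s \<noteq> {}" "finite t" "t \<noteq> {}" "s \<inter> t = {}"
    and "\<And>G. G \<in> F1 \<Longrightarrow> \<not> s \<subseteq> G" "\<And>G. G \<in> F1 \<Longrightarrow> \<not> t \<subseteq> G"
  shows "is_sphere (F1 \<union> (\<lambda>a. (s \<union> t) - {a}) ` s)"
  using sphere_faces_flip[of "F1 \<union> (\<lambda>a. (s \<union> t) - {a}) ` t" s t F1] assms
  unfolding is_sphere_def by blast

text \<open>In every case \<open>s \<union> t\<close> consists of \<open>V k\<close>, which lies in
  \<open>t\<close>, and the four vertices of the new square. Omitting \<open>V k\<close> gives the
  tetrahedron, omitting another vertex of \<open>t\<close> gives a cone facet over a wall shared
  with \<open>R\<close>, and omitting a vertex of \<open>s\<close> gives one over a wall that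
  appears.\<close>

lemma is_sphere_add_square:
  assumes sphere: "is_sphere (F0 \<union> {tet (Suc i) (Suc j)} \<union> boundary_cone (V k) R)"
    and F0: "\<And>G. G \<in> F0 \<Longrightarrow> V k \<notin> G \<and> avoids p q (insert (Suc i, Suc j) R) G"
    and new: "(Suc i, Suc j) \<notin> R" and pq: "Suc (Suc i) < p" "Suc j < q"
    and "addable R i j"
  shows "is_sphere (F0 \<union> boundary_cone (V k) (insert (Suc i, Suc j) R))"
  using \<open>addable R i j\<close> unfolding addable_def
proof (elim disjE conjE)
  assume R: "R = {}"
  define s where "s = tet (Suc i) (Suc j)"
  define t where "t = {V k}"
  have "(\<lambda>a. (s \<union> t) - {a}) ` t = {tet (Suc i) (Suc j)}"
    by (auto simp: s_def t_def tet_def)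
  moreover have "boundary_cone (V k) R = {}" by (auto simp: R cone_over_def vertical_boundary_def horizontal_boundary_def)
  ultimately have 1: "is_sphere (F0 \<union> (\<lambda>a. (s \<union> t) - {a}) ` t)"
    using sphere by simp
  have "\<not> s \<subseteq> G" if "G \<in> F0" for G
    by (rule not_subset_if_avoids[OF conjunct2[OF F0[OF that]], of "Suc i" _ "Suc j"])
      (use pq in \<open>auto simp: s_def tet_def imp_disjL all_conj_distrib\<close>)
  moreover have "\<not> t \<subseteq> G" if "G \<in> F0" for G
    using F0[OF that] by (auto simp: t_def)
  ultimately have "is_sphere (F0 \<union> (\<lambda>a. (s \<union> t) - {a}) ` s)"
    by (intro is_sphere_flip[OF 1]) (auto simp: s_def t_def tet_def)
  moreover have "vertical_boundary (insert (Suc i, Suc j) R) = {(i, Suc j), (Suc i, Suc j)}"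
    "horizontal_boundary (insert (Suc i, Suc j) R) = {(Suc i, j), (Suc i, Suc j)}"
    by (auto simp: R vertical_boundary_def horizontal_boundary_def)
  then have "boundary_cone (V k) (insert (Suc i, Suc j) R) = (\<lambda>a. (s \<union> t) - {a}) ` s"
    by (auto simp: s_def t_def cone_over_def vertical_triangle_def horizontal_triangle_def tet_def insert_commute insert_Diff_if)
  ultimately show ?thesis by simp
next
  assume left: "(i, Suc j) \<in> R" and free: "\<forall>y. (Suc i, y) \<notin> R \<and> (Suc (Suc i), y) \<notin> R"
  define s where "s = {A (Suc i), B (Suc j), B (Suc (Suc j))}"
  define t where "t = {V k, A (Suc (Suc i))}"
  \<comment> \<open>\<open>C\<close> is the part of the cone that the flip leaves alone.\<close>
  define C where "C = cone_over (V k) (vertical_boundary R - {(i, Suc j)}) (horizontal_boundary R)"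
  have "vertical_boundary R = (vertical_boundary R - {(i, Suc j)}) \<union> {(i, Suc j)}" "horizontal_boundary R = horizontal_boundary R \<union> {}"
    using left free by (auto simp: vertical_boundary_def)
  then have "boundary_cone (V k) R = C \<union> cone_over (V k) {(i, Suc j)} {}"
    unfolding C_def using cone_over_Un by metis
  then have "F0 \<union> {tet (Suc i) (Suc j)} \<union> boundary_cone (V k) R = (F0 \<union> C) \<union> (\<lambda>a. (s \<union> t) - {a}) ` t"
    by (auto simp: s_def t_def cone_over_def vertical_triangle_def tet_def insert_commute insert_Diff_if)
  with sphere have 1: "is_sphere ((F0 \<union> C) \<union> (\<lambda>a. (s \<union> t) - {a}) ` t)" by simp
  have "\<not> s \<subseteq> G" if "G \<in> F0" for G
    by (rule not_subset_if_avoids[OF conjunct2[OF F0[OF that]], of "Suc i" _ "Suc j"])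
      (use pq left in \<open>auto simp: s_def imp_disjL all_conj_distrib\<close>)
  moreover have "\<not> t \<subseteq> G" if "G \<in> F0" for G
    using F0[OF that] by (auto simp: t_def)
  \<comment> \<open>\<open>s\<close> is the wall removed from the cone. By \<open>free\<close>, no
    wall of \<open>R\<close> contains \<open>A (Suc (Suc i))\<close>, so no facet of
    \<open>C\<close> contains \<open>t\<close>.\<close>
  moreover have "\<not> s \<subseteq> G" "\<not> t \<subseteq> G" if "G \<in> C" for G
    using that left free
    by (auto simp: C_def s_def t_def cone_over_def vertical_triangle_def horizontal_triangle_def vertical_boundary_def horizontal_boundary_def)
  ultimately have "\<not> s \<subseteq> G" "\<not> t \<subseteq> G" if "G \<in> F0 \<union> C" for G
    using that by blast+
  then have "is_sphere ((F0 \<union> C) \<union> (\<lambda>a. (s \<union> t) - {a}) ` s)"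
    by (intro is_sphere_flip[OF 1]) (simp_all add: s_def t_def)
  moreover have "vertical_boundary (insert (Suc i, Suc j) R) = (vertical_boundary R - {(i, Suc j)}) \<union> {(Suc i, Suc j)}"
    "horizontal_boundary (insert (Suc i, Suc j) R) = horizontal_boundary R \<union> {(Suc i, j), (Suc i, Suc j)}"
    using left free by (auto simp: vertical_boundary_def horizontal_boundary_def)
  then have "boundary_cone (V k) (insert (Suc i, Suc j) R) =
      C \<union> cone_over (V k) {(Suc i, Suc j)} {(Suc i, j), (Suc i, Suc j)}"
    unfolding C_def using cone_over_Un by metis
  then have "F0 \<union> boundary_cone (V k) (insert (Suc i, Suc j) R) = (F0 \<union> C) \<union> (\<lambda>a. (s \<union> t) - {a}) ` s"
    by (auto simp: s_def t_def cone_over_def vertical_triangle_def horizontal_triangle_def insert_commute insert_Diff_if)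
  ultimately show ?thesis by simp
next
  assume bottom: "(Suc i, j) \<in> R" and free: "\<forall>x. (x, Suc j) \<notin> R \<and> (x, Suc (Suc j)) \<notin> R"
  \<comment> \<open>This is the previous case with rows and columns exchanged.\<close>
  define s where "s = {A (Suc i), A (Suc (Suc i)), B (Suc j)}"
  define t where "t = {V k, B (Suc (Suc j))}"
  define C where "C = cone_over (V k) (vertical_boundary R) (horizontal_boundary R - {(Suc i, j)})"
  have "horizontal_boundary R = (horizontal_boundary R - {(Suc i, j)}) \<union> {(Suc i, j)}" "vertical_boundary R = vertical_boundary R \<union> {}"
    using bottom free by (auto simp: horizontal_boundary_def)
  then have "boundary_cone (V k) R = C \<union> cone_over (V k) {} {(Suc i, j)}"
    unfolding C_def using cone_over_Un by metis
  then have "F0 \<union> {tet (Suc i) (Suc j)} \<union> boundary_cone (V k) R = (F0 \<union> C) \<union> (\<lambda>a. (s \<union> t) - {a}) ` t"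
    by (auto simp: s_def t_def cone_over_def horizontal_triangle_def tet_def insert_commute insert_Diff_if)
  with sphere have 1: "is_sphere ((F0 \<union> C) \<union> (\<lambda>a. (s \<union> t) - {a}) ` t)" by simp
  have "\<not> s \<subseteq> G" if "G \<in> F0" for G
    by (rule not_subset_if_avoids[OF conjunct2[OF F0[OF that]], of "Suc i" _ "Suc j"])
      (use pq bottom in \<open>auto simp: s_def imp_disjL all_conj_distrib\<close>)
  moreover have "\<not> t \<subseteq> G" if "G \<in> F0" for G
    using F0[OF that] by (auto simp: t_def)
  moreover have "\<not> s \<subseteq> G" "\<not> t \<subseteq> G" if "G \<in> C" for G
    using that bottom free
    by (auto simp: C_def s_def t_def cone_over_def vertical_triangle_def horizontal_triangle_def vertical_boundary_def horizontal_boundary_def)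
  ultimately have "\<not> s \<subseteq> G" "\<not> t \<subseteq> G" if "G \<in> F0 \<union> C" for G
    using that by blast+
  then have "is_sphere ((F0 \<union> C) \<union> (\<lambda>a. (s \<union> t) - {a}) ` s)"
    by (intro is_sphere_flip[OF 1]) (simp_all add: s_def t_def)
  moreover have "horizontal_boundary (insert (Suc i, Suc j) R) = (horizontal_boundary R - {(Suc i, j)}) \<union> {(Suc i, Suc j)}"
    "vertical_boundary (insert (Suc i, Suc j) R) = vertical_boundary R \<union> {(i, Suc j), (Suc i, Suc j)}"
    using bottom free by (auto simp: vertical_boundary_def horizontal_boundary_def)
  then have "boundary_cone (V k) (insert (Suc i, Suc j) R) =
      C \<union> cone_over (V k) {(i, Suc j), (Suc i, Suc j)} {(Suc i, Suc j)}"
    unfolding C_def using cone_over_Un by metis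
  then have "F0 \<union> boundary_cone (V k) (insert (Suc i, Suc j) R) = (F0 \<union> C) \<union> (\<lambda>a. (s \<union> t) - {a}) ` s"
    by (auto simp: s_def t_def cone_over_def vertical_triangle_def horizontal_triangle_def insert_commute insert_Diff_if)
  ultimately show ?thesis by simp
next
  assume corner: "(Suc i, j) \<in> R" "(Suc (Suc i), j) \<in> R" "(Suc (Suc i), Suc j) \<in> R"
    and free: "(i, Suc j) \<notin> R" "(i, Suc (Suc j)) \<notin> R" "(Suc i, Suc (Suc j)) \<notin> R"
  define s where "s = {A (Suc (Suc i)), B (Suc j)}"
  define t where "t = {V k, A (Suc i), B (Suc (Suc j))}"
  define C where "C = cone_over (V k) (vertical_boundary R - {(Suc i, Suc j)}) (horizontal_boundary R - {(Suc i, j)})"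
  have "horizontal_boundary R = (horizontal_boundary R - {(Suc i, j)}) \<union> {(Suc i, j)}"
    "vertical_boundary R = (vertical_boundary R - {(Suc i, Suc j)}) \<union> {(Suc i, Suc j)}"
    using corner new by (auto simp: horizontal_boundary_def vertical_boundary_def)
  then have "boundary_cone (V k) R = C \<union> cone_over (V k) {(Suc i, Suc j)} {(Suc i, j)}"
    unfolding C_def using cone_over_Un by metis
  then have "F0 \<union> {tet (Suc i) (Suc j)} \<union> boundary_cone (V k) R = (F0 \<union> C) \<union> (\<lambda>a. (s \<union> t) - {a}) ` t"
    by (auto simp: s_def t_def cone_over_def vertical_triangle_def horizontal_triangle_def tet_def insert_commute insert_Diff_if)
  with sphere have 1: "is_sphere ((F0 \<union> C) \<union> (\<lambda>a. (s \<union> t) - {a}) ` t)" by simp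
  have "\<not> s \<subseteq> G" if "G \<in> F0" for G
    by (rule not_subset_if_avoids[OF conjunct2[OF F0[OF that]], of "Suc (Suc i)" _ "Suc j"])
      (use pq corner in \<open>auto simp: s_def imp_disjL all_conj_distrib\<close>)
  moreover have "\<not> t \<subseteq> G" if "G \<in> F0" for G
    using F0[OF that] by (auto simp: t_def)
  \<comment> \<open>Around the grid point \<open>s\<close> only the new square is outside
    \<open>R\<close>, so just two walls meet there, both removed from \<open>C\<close>. Around the
    opposite corner of the new square all four squares are outside \<open>R\<close>, so no wall
    meets it.\<close>
  moreover have "\<not> s \<subseteq> G" "\<not> t \<subseteq> G" if "G \<in> C" for G
    using that corner free new
    by (auto simp: C_def s_def t_def cone_over_def vertical_triangle_def horizontal_triangle_def vertical_boundary_def horizontal_boundary_def)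
  ultimately have "\<not> s \<subseteq> G" "\<not> t \<subseteq> G" if "G \<in> F0 \<union> C" for G
    using that by blast+
  then have "is_sphere ((F0 \<union> C) \<union> (\<lambda>a. (s \<union> t) - {a}) ` s)"
    by (intro is_sphere_flip[OF 1]) (simp_all add: s_def t_def)
  moreover have "horizontal_boundary (insert (Suc i, Suc j) R) = (horizontal_boundary R - {(Suc i, j)}) \<union> {(Suc i, Suc j)}"
    "vertical_boundary (insert (Suc i, Suc j) R) = (vertical_boundary R - {(Suc i, Suc j)}) \<union> {(i, Suc j)}"
    using corner free new by (auto simp: vertical_boundary_def horizontal_boundary_def)
  then have "boundary_cone (V k) (insert (Suc i, Suc j) R) =
      C \<union> cone_over (V k) {(i, Suc j)} {(Suc i, Suc j)}"
    unfolding C_def using cone_over_Un by metis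
  then have "F0 \<union> boundary_cone (V k) (insert (Suc i, Suc j) R) = (F0 \<union> C) \<union> (\<lambda>a. (s \<union> t) - {a}) ` s"
    by (auto simp: s_def t_def cone_over_def vertical_triangle_def horizontal_triangle_def insert_commute insert_Diff_if)
  ultimately show ?thesis by simp
qed

definition tets :: "(nat \<times> nat) set \<Rightarrow> vertex set set" where
  "tets Q = (\<lambda>(i, j). tet i j) ` Q"

lemma tet_avoids:
  assumes "(x, y) \<notin> R"
  shows "V k \<notin> tet x y \<and> avoids p q R (tet x y)"
proof -
  have "(\<forall>i. A i \<in> tet x y \<longrightarrow> i = x \<or> i = Suc x) \<and> (\<forall>j. B j \<in> tet x y \<longrightarrow> j = y \<or> j = Suc y)"
    by (auto simp: tet_def)
  then have "avoids p q R (tet x y)" unfolding avoids_def using assms by blast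
  then show ?thesis by (simp add: tet_def)
qed

text \<open>One step of growing the coned part \<open>P\<close> inside its target \<open>R\<close>.
  The squares of \<open>R\<close> still to be coned are present as tetrahedra, and each of them
  avoids the enlarged part by \<open>tet_avoids\<close>.\<close>

lemma is_sphere_cone_extend:
  assumes sphere: "is_sphere (F0 \<union> tets (R - P) \<union> boundary_cone (V k) P)"
    and F0: "\<And>G. G \<in> F0 \<Longrightarrow> V k \<notin> G \<and> avoids p q R G"
    and P: "P \<subseteq> R" "(Suc i, Suc j) \<in> R" "(Suc i, Suc j) \<notin> P"
    and pq: "Suc (Suc i) < p" "Suc j < q" and add: "addable P i j"
  shows "is_sphere (F0 \<union> tets (R - insert (Suc i, Suc j) P) \<union>
           boundary_cone (V k) (insert (Suc i, Suc j) P))"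
proof (rule is_sphere_add_square[OF _ _ P(3) pq add])
  have "R - P = insert (Suc i, Suc j) (R - insert (Suc i, Suc j) P)" using P by blast
  then have "tets (R - P) = tets (R - insert (Suc i, Suc j) P) \<union> {tet (Suc i) (Suc j)}"
    by (metis (no_types, lifting) Un_insert_right image_insert prod.case tets_def sup_bot_right)
  with sphere show "is_sphere (F0 \<union> tets (R - insert (Suc i, Suc j) P) \<union> {tet (Suc i) (Suc j)} \<union>
      boundary_cone (V k) P)"
    by (simp only: Un_assoc)
next
  fix G assume "G \<in> F0 \<union> tets (R - insert (Suc i, Suc j) P)"
  then show "V k \<notin> G \<and> avoids p q (insert (Suc i, Suc j) P) G"
  proof
    assume "G \<in> F0"
    then show ?thesis using F0 P avoids_mono[of p q R G] by simp
  next
    assume "G \<in> tets (R - insert (Suc i, Suc j) P)"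
    then obtain x y where xy: "G = tet x y" "(x, y) \<notin> insert (Suc i, Suc j) P"
      by (auto simp: tets_def)
    then show ?thesis using tet_avoids by blast
  qed
qed

subsection \<open>Coning off diagonal strips\<close>

text \<open>The diagonals \<open>3 * k\<close> and \<open>3 * k + 1\<close> always belong to strip \<open>k\<close>; the squares of the
  diagonal \<open>3 * k + 2\<close> are optional and encode the choice \<open>W\<close>.\<close>

definition strip :: "nat \<Rightarrow> nat \<Rightarrow> nat set \<Rightarrow> (nat \<times> nat) set" where
  "strip N k W = {(x, y). 1 \<le> x \<and> x \<le> Suc N \<and> (y = x + 3 * k \<or> y = x + 3 * k + 1) \<or>
     x \<in> W \<and> y = x + 3 * k + 2}"

text \<open>Enumerates the two compulsory diagonals as a staircase that alternately steps up and right.\<close>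

definition snake :: "nat \<Rightarrow> nat \<Rightarrow> nat \<times> nat" where
  "snake k n = (Suc (n div 2), Suc (Suc n div 2 + 3 * k))"

text \<open>\<open>n div 2 + Suc n div 2 = n\<close>, so the coordinates determine
  \<open>n\<close>.\<close>

lemma snake_notin: "snake k n \<notin> snake k ` {..<n}"
proof
  assume "snake k n \<in> snake k ` {..<n}"
  then obtain m where "m < n" "n div 2 = m div 2" "Suc n div 2 = Suc m div 2"
    by (auto simp: snake_def)
  moreover have "l div 2 + Suc l div 2 = l" for l :: nat by presburger
  ultimately show False by (metis less_irrefl)
qed

text \<open>For even \<open>n > 0\<close> the staircase has just stepped right: the left neighbour
  is present and the columns from the new one on are empty. For odd \<open>n\<close> it has stepped
  up: the bottom neighbour is present and the rows from the new one on are empty.\<close>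

lemma addable_snake: "addable (snake k ` {..<n}) (n div 2) (Suc n div 2 + 3 * k)"
proof (cases "even n")
  case True
  then obtain i where i: "n = 2 * i" by blast
  show ?thesis
  proof (cases i)
    case 0
    then show ?thesis by (simp add: addable_def i)
  next
    case (Suc i')
    have "snake k (Suc (2 * i')) = (i, Suc (i + 3 * k))" by (simp add: snake_def Suc)
    then have "(i, Suc (i + 3 * k)) \<in> snake k ` {..<n}"
      using i Suc by (metis image_eqI lessThan_iff lessI mult_Suc_right add_2_eq_Suc)
    moreover have "(Suc i, y) \<notin> snake k ` {..<n}" "(Suc (Suc i), y) \<notin> snake k ` {..<n}" for y
      using i by (auto simp: snake_def)
    moreover have "n div 2 = i" "Suc n div 2 = i" using i by auto
    ultimately show ?thesis unfolding addable_def by auto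
  qed
next
  case False
  then obtain i where i: "n = 2 * i + 1" using oddE by blast
  have "snake k (2 * i) = (Suc i, i + 1 + 3 * k)" by (simp add: snake_def)
  then have "(Suc i, i + 1 + 3 * k) \<in> snake k ` {..<n}"
    using i by (metis image_eqI lessThan_iff less_add_one)
  moreover have "(x, Suc (i + 1 + 3 * k)) \<notin> snake k ` {..<n}"
    "(x, Suc (Suc (i + 1 + 3 * k))) \<notin> snake k ` {..<n}" for x
    using i by (auto simp: snake_def)
  moreover have "n div 2 = i" "Suc n div 2 = i + 1" using i by auto
  ultimately show ?thesis unfolding addable_def by auto
qed

lemma snake_image: "snake k ` {..<2 * N + 2} = strip N k {}"
proof (intro equalityI subsetI)
  fix z assume "z \<in> snake k ` {..<2 * N + 2}"
  then obtain n where n: "n < 2 * N + 2" "z = snake k n" by auto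
  then have "Suc n div 2 = n div 2 \<or> Suc n div 2 = Suc (n div 2)" "n div 2 \<le> N" by presburger+
  then show "z \<in> strip N k {}" using n by (auto simp: strip_def snake_def)
next
  fix z assume "z \<in> strip N k {}"
  then obtain x where x: "1 \<le> x" "x \<le> Suc N" "z = (x, x + 3 * k) \<or> z = (x, x + 3 * k + 1)"
    by (auto simp: strip_def)
  then obtain i where i: "x = Suc i" "i \<le> N" by (cases x) auto
  have "snake k (2 * i) = (x, x + 3 * k)" "snake k (2 * i + 1) = (x, x + 3 * k + 1)"
    by (auto simp: snake_def i)
  moreover have "snake k (2 * i) \<in> snake k ` {..<2 * N + 2}" "snake k (2 * i + 1) \<in> snake k ` {..<2 * N + 2}"
    using i by auto
  ultimately show "z \<in> snake k ` {..<2 * N + 2}" using x(3) by metis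
qed

text \<open>The compulsory squares are coned first, in the order of \<open>snake\<close>, then the
  optional ones in arbitrary order: whether an optional square can be added does not depend on the
  others.\<close>

lemma is_sphere_cone_strip:
  assumes sphere: "is_sphere (F0 \<union> tets (strip N k W))" and W: "W \<subseteq> {1..N}"
    and F0: "\<And>G. G \<in> F0 \<Longrightarrow> V k \<notin> G \<and> avoids p q (strip N k W) G"
    and pq: "N + 2 < p" "N + 3 * k + 2 < q"
  shows "is_sphere (F0 \<union> boundary_cone (V k) (strip N k W))"
proof -
  define R where "R = strip N k W"
  have snake_in: "snake k n \<in> R" if "n < 2 * N + 2" for n
  proof -
    have "snake k n \<in> strip N k {}" using that snake_image[of k N] by blast
    then show ?thesis by (auto simp: R_def strip_def)
  qed
  have "is_sphere (F0 \<union> tets (R - snake k ` {..<n}) \<union> boundary_cone (V k) (snake k ` {..<n}))"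
    if "n \<le> 2 * N + 2" for n
    using that
  proof (induction n)
    case 0
    then show ?case
      using sphere by (simp add: R_def cone_over_def vertical_boundary_def horizontal_boundary_def)
  next
    case (Suc n)
    have "is_sphere (F0 \<union> tets (R - insert (Suc (n div 2), Suc (Suc n div 2 + 3 * k)) (snake k ` {..<n})) \<union>
        boundary_cone (V k) (insert (Suc (n div 2), Suc (Suc n div 2 + 3 * k)) (snake k ` {..<n})))"
    proof (rule is_sphere_cone_extend[OF _ F0[folded R_def]])
      show "snake k ` {..<n} \<subseteq> R" using snake_in Suc.prems by auto
      show "(Suc (n div 2), Suc (Suc n div 2 + 3 * k)) \<in> R"
        using snake_in[of n] Suc.prems by (simp add: snake_def)
      show "(Suc (n div 2), Suc (Suc n div 2 + 3 * k)) \<notin> snake k ` {..<n}"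
        using snake_notin[of k n] by (simp add: snake_def)
    qed (use Suc pq addable_snake in auto)
    then show ?case by (simp add: lessThan_Suc snake_def)
  qed
  from this[of "2 * N + 2"]
  have start: "is_sphere (F0 \<union> tets (R - strip N k {}) \<union> boundary_cone (V k) (strip N k {}))"
    by (simp only: snake_image order_refl simp_thms)
  have "finite W" using W by (rule finite_subset) simp
  have "is_sphere (F0 \<union> tets (R - strip N k W') \<union> boundary_cone (V k) (strip N k W'))"
    if "W' \<subseteq> W" for W'
    using finite_subset[OF that \<open>finite W\<close>] that
  proof (induction W' rule: finite_induct)
    case empty
    then show ?case by (simp add: start)
  next
    case (insert x W')
    then obtain i where i: "x = Suc i" "Suc i \<le> N" using W by (cases x) auto
    have ins: "strip N k (insert x W') = insert (Suc i, Suc (i + 3 * k + 2)) (strip N k W')"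
      using i by (auto simp: strip_def)
    show ?case
      unfolding ins
    proof (rule is_sphere_cone_extend[OF _ F0[folded R_def]])
      show "strip N k W' \<subseteq> R" "(Suc i, Suc (i + 3 * k + 2)) \<in> R"
        using insert i by (auto simp: R_def strip_def)
      show "(Suc i, Suc (i + 3 * k + 2)) \<notin> strip N k W'"
        using insert i by (auto simp: strip_def)
      \<comment> \<open>The bottom, bottom right and right neighbours lie on the compulsory
        diagonals, which extend to column \<open>Suc N\<close> for the sake of \<open>x = N\<close>.
        The other three squares of the 3-2 case lie on the diagonals \<open>3 * k + 3\<close> and
        \<open>3 * k + 4\<close>, outside the strip.\<close>
      show "addable (strip N k W') i (i + 3 * k + 2)"
        unfolding addable_def using i by (intro disjI2) (auto simp: strip_def)
    qed (use insert i pq in auto)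
  qed
  from this[of W] show ?thesis by (simp add: R_def tets_def)
qed

section \<open>Coning off all strips of the join of two cycles\<close>

definition outer_facets :: "nat \<Rightarrow> nat \<Rightarrow> vertex set set" where
  "outer_facets p q = join {{A 0, A p}} (cycle_edges B q) \<union> join (cycle_edges A p) {{B 0, B q}}"

lemma join_cycles_eq: "join (cycle_edges A p) (cycle_edges B q) = outer_facets p q \<union> tets ({..<p} \<times> {..<q})"
proof -
  define a b where "a = (\<lambda>i. {A i, A (Suc i)}) ` {..<p}" and "b = (\<lambda>i. {B i, B (Suc i)}) ` {..<q}"
  have "join ({u} \<union> a) ({v} \<union> b) = join {u} ({v} \<union> b) \<union> join ({u} \<union> a) {v} \<union> join a b" for u v
    unfolding join_Un_left join_Un_right by (simp add: Un_ac)
  moreover have "join a b = tets ({..<p} \<times> {..<q})"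
  proof -
    have "tet i j = {A i, A (Suc i)} \<union> {B j, B (Suc j)}" for i j by (auto simp: tet_def)
    then show ?thesis by (simp only: join_images tets_def a_def b_def)
  qed
  ultimately show ?thesis
    by (simp add: outer_facets_def cycle_edges_def a_def b_def)
qed

text \<open>\<open>t\<close> counts the strips already coned off, for the induction from the join of
  the cycles at \<open>t = 0\<close> to the final sphere at \<open>t = N\<close>.\<close>

definition sphere_facets :: "nat \<Rightarrow> nat \<Rightarrow> nat \<Rightarrow> (nat \<Rightarrow> nat set) \<Rightarrow> nat \<Rightarrow> vertex set set" where
  "sphere_facets p q N W t = outer_facets p q \<union>
     tets ({..<p} \<times> {..<q} - (\<Union>l<t. strip N l (W l))) \<union>
     (\<Union>l<t. boundary_cone (V l) (strip N l (W l)))"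

text \<open>On strip \<open>k\<close> the difference \<open>y - x\<close> lies between
  \<open>3 * k\<close> and \<open>3 * k + 2\<close>.\<close>

lemma strip_disjoint: "k \<noteq> l \<Longrightarrow> (x, y) \<in> strip N k W \<Longrightarrow> (x, y) \<notin> strip N l W'"
  unfolding strip_def by auto

text \<open>Such a facet uses the closing edge of one of the cycles, so all its grid points lie on
  the border of the grid.\<close>

lemma outer_facets_avoids:
  assumes "G \<in> outer_facets p q"
  shows "V k \<notin> G \<and> avoids p q R G"
proof -
  have "\<not> (A i \<in> G \<and> B j \<in> G \<and> 0 < i \<and> i < p \<and> 0 < j \<and> j < q)" for i j
    using assms by (auto simp: outer_facets_def join_def cycle_edges_def)
  moreover have "V k \<notin> G"
    using assms by (auto simp: outer_facets_def join_def cycle_edges_def)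
  ultimately show ?thesis unfolding avoids_def by blast
qed

text \<open>A wall of \<open>R'\<close> is a side of some square in \<open>R'\<close>. By
  disjointness that square is not in \<open>R\<close>, so it witnesses the second alternative of
  \<open>avoids\<close>.\<close>

lemma boundary_cone_avoids:
  assumes "G \<in> boundary_cone (V l) R'" "R \<inter> R' = {}" "k \<noteq> l"
  shows "V k \<notin> G \<and> avoids p q R G"
proof -
  have *: "avoids p q R (insert (V l) (vertical_triangle x y))" if xy: "(x, y) \<in> R' \<or> (Suc x, y) \<in> R'" for x y
  proof -
    obtain x' where "x' = x \<or> x' = Suc x" "(x', y) \<notin> R"
      using xy assms(2) by blast
    then have "\<exists>x' y'. (x', y') \<notin> R \<and> (\<forall>i. A i \<in> insert (V l) (vertical_triangle x y) \<longrightarrow> i = x' \<or> i = Suc x') \<and>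
        (\<forall>j. B j \<in> insert (V l) (vertical_triangle x y) \<longrightarrow> j = y' \<or> j = Suc y')"
      by (intro exI[of _ x'] exI[of _ y]) (auto simp: vertical_triangle_def)
    then show ?thesis unfolding avoids_def by blast
  qed
  have **: "avoids p q R (insert (V l) (horizontal_triangle x y))" if xy: "(x, y) \<in> R' \<or> (x, Suc y) \<in> R'" for x y
  proof -
    obtain y' where "y' = y \<or> y' = Suc y" "(x, y') \<notin> R"
      using xy assms(2) by blast
    then have "\<exists>x' y'. (x', y') \<notin> R \<and> (\<forall>i. A i \<in> insert (V l) (horizontal_triangle x y) \<longrightarrow> i = x' \<or> i = Suc x') \<and>
        (\<forall>j. B j \<in> insert (V l) (horizontal_triangle x y) \<longrightarrow> j = y' \<or> j = Suc y')"
      by (intro exI[of _ x] exI[of _ y']) (auto simp: horizontal_triangle_def)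
    then show ?thesis unfolding avoids_def by blast
  qed
  obtain x y where
    "G = insert (V l) (vertical_triangle x y) \<and> ((x, y) \<in> R' \<or> (Suc x, y) \<in> R') \<or>
     G = insert (V l) (horizontal_triangle x y) \<and> ((x, y) \<in> R' \<or> (x, Suc y) \<in> R')"
    using assms(1) by (auto simp: cone_over_def vertical_boundary_def horizontal_boundary_def)
  then have "avoids p q R G" "G = insert (V l) (vertical_triangle x y) \<or> G = insert (V l) (horizontal_triangle x y)"
    using * ** by blast+
  then show ?thesis using assms(3) by (auto simp: vertical_triangle_def horizontal_triangle_def)
qed

text \<open>The bounds on \<open>p\<close> and \<open>q\<close> keep all strips inside the grid:
  their columns are at most \<open>N + 1\<close> and their rows at most \<open>4 * N - 1\<close>. In
  each step \<open>F0\<close> collects all facets not coming from strip \<open>t\<close>.\<close>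

lemma is_sphere_sphere_facets:
  assumes pq: "N + 2 < p" "4 * N < q" "2 \<le> q" and W: "\<And>l. W l \<subseteq> {1..N}" and "t \<le> N"
  shows "is_sphere (sphere_facets p q N W t)"
  using \<open>t \<le> N\<close>
proof (induction t)
  case 0
  have "is_sphere (join (cycle_edges A p) (cycle_edges B q))"
    by (rule is_sphere_join_cycles) (use pq in \<open>auto simp: inj_def\<close>)
  then show ?case by (simp add: sphere_facets_def join_cycles_eq)
next
  case (Suc t)
  define R where "R l = strip N l (W l)" for l
  define F0 where "F0 = outer_facets p q \<union> tets ({..<p} \<times> {..<q} - (\<Union>l<Suc t. R l)) \<union>
     (\<Union>l<t. boundary_cone (V l) (R l))"
  have disj: "R l \<inter> R t = {}" if "l < t" for l
    using strip_disjoint[of l t] that by (auto simp: R_def)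
  have "R t \<subseteq> {..<p} \<times> {..<q}"
    using pq W[of t] Suc.prems by (auto simp: R_def strip_def)
  then have "{..<p} \<times> {..<q} - (\<Union>l<t. R l) = ({..<p} \<times> {..<q} - (\<Union>l<Suc t. R l)) \<union> R t"
    using disj by (auto simp: lessThan_Suc)
  then have split: "tets ({..<p} \<times> {..<q} - (\<Union>l<t. R l)) =
      tets ({..<p} \<times> {..<q} - (\<Union>l<Suc t. R l)) \<union> tets (R t)"
    unfolding tets_def by (metis image_Un)
  have "sphere_facets p q N W t = F0 \<union> tets (R t)"
    unfolding sphere_facets_def R_def[symmetric] split F0_def by (simp only: Un_ac)
  then have "is_sphere (F0 \<union> tets (strip N t (W t)))"
    using Suc by (simp add: R_def)
  then have "is_sphere (F0 \<union> boundary_cone (V t) (strip N t (W t)))"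
  proof (rule is_sphere_cone_strip[OF _ W])
    fix G assume "G \<in> F0"
    then consider "G \<in> outer_facets p q" | x y where "G = tet x y" "(x, y) \<notin> R t"
      | l where "l < t" "G \<in> boundary_cone (V l) (R l)"
      unfolding F0_def tets_def by (auto simp: lessThan_Suc)
    then show "V t \<notin> G \<and> avoids p q (strip N t (W t)) G"
      unfolding R_def[symmetric]
    proof cases
      case 1
      then show "V t \<notin> G \<and> avoids p q (R t) G" by (rule outer_facets_avoids)
    next
      case (2 x y)
      then show "V t \<notin> G \<and> avoids p q (R t) G" using tet_avoids by simp
    next
      case (3 l)
      then show "V t \<notin> G \<and> avoids p q (R t) G"
        using disj[of l] by (intro boundary_cone_avoids[of G l "R l"]) auto
    qed
  qed (use pq Suc.prems in auto)
  moreover have "sphere_facets p q N W (Suc t) = F0 \<union> boundary_cone (V t) (R t)"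
    unfolding sphere_facets_def R_def[symmetric] F0_def lessThan_Suc by (simp add: Un_ac)
  ultimately show ?case by (simp add: R_def)
qed

section \<open>Vertex set of the spheres and recovery of the choices\<close>

lemma vertices_faces: "vertices (faces F) = \<Union>F"
  unfolding vertices_def faces_def by blast

lemma Union_cycle: "\<Union>(cycle_edges f n) = f ` {..n}"
proof (intro equalityI subsetI)
  fix v assume "v \<in> f ` {..n}"
  then obtain i where "v = f i" "i < n \<or> i = n" by force
  then show "v \<in> \<Union>(cycle_edges f n)" by (auto simp: cycle_edges_def)
qed (auto simp: cycle_edges_def)

lemma Union_join: "E \<noteq> {} \<Longrightarrow> H \<noteq> {} \<Longrightarrow> \<Union>(join E H) = \<Union>E \<union> \<Union>H"
  unfolding join_def by blast

lemma Union_outer_facets: "\<Union>(outer_facets p q) = A ` {..p} \<union> B ` {..q}"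
proof -
  have "cycle_edges f n \<noteq> {}" for f :: "nat \<Rightarrow> vertex" and n by (simp add: cycle_edges_def)
  then show ?thesis
    unfolding outer_facets_def by (auto simp: Union_join Union_cycle)
qed

lemma boundary_cone_subset_tet:
  assumes "G \<in> boundary_cone v R"
  obtains x y where "(x, y) \<in> R" "G \<subseteq> insert v (tet x y)"
proof -
  have sub: "insert v (vertical_triangle x y) \<subseteq> insert v (tet x y)" "insert v (vertical_triangle x y) \<subseteq> insert v (tet (Suc x) y)"
    "insert v (horizontal_triangle x y) \<subseteq> insert v (tet x y)" "insert v (horizontal_triangle x y) \<subseteq> insert v (tet x (Suc y))" for x y
    by (auto simp: vertical_triangle_def horizontal_triangle_def tet_def)
  obtain x y where
    "G = insert v (vertical_triangle x y) \<and> ((x, y) \<in> R \<or> (Suc x, y) \<in> R) \<or>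
     G = insert v (horizontal_triangle x y) \<and> ((x, y) \<in> R \<or> (x, Suc y) \<in> R)"
    using assms by (auto simp: cone_over_def vertical_boundary_def horizontal_boundary_def)
  then show ?thesis using sub that by metis
qed

lemma vertices_sphere_facets:
  assumes pq: "N + 2 < p" "4 * N < q" and W: "\<And>l. W l \<subseteq> {1..N}"
  shows "vertices (faces (sphere_facets p q N W N)) = A ` {..p} \<union> B ` {..q} \<union> V ` {..<N}"
proof -
  have tet: "tet x y \<subseteq> A ` {..p} \<union> B ` {..q}" if "x < p" "y < q" for x y
    using that by (auto simp: tet_def)
  have strip: "x < p \<and> y < q" if "(x, y) \<in> strip N l (W l)" "l < N" for x y l
    using that W[of l] pq by (auto simp: strip_def)
  have "G \<subseteq> A ` {..p} \<union> B ` {..q} \<union> V ` {..<N}" if Gin: "G \<in> sphere_facets p q N W N" for G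
  proof -
    consider "G \<in> outer_facets p q" | "G \<in> tets ({..<p} \<times> {..<q})"
      | l where "l < N" "G \<in> boundary_cone (V l) (strip N l (W l))"
      using Gin unfolding sphere_facets_def tets_def by auto
    then show ?thesis
    proof cases
      case 1
      then show ?thesis using Union_outer_facets[of p q] by blast
    next
      case 2
      then obtain x y where "G = tet x y" "x < p" "y < q" by (auto simp: tets_def)
      then show ?thesis using tet by blast
    next
      case (3 l)
      then obtain x y where xy: "(x, y) \<in> strip N l (W l)" "G \<subseteq> insert (V l) (tet x y)"
        using boundary_cone_subset_tet by metis
      then have "tet x y \<subseteq> A ` {..p} \<union> B ` {..q}" using tet strip 3 by blast
      then show ?thesis using xy 3 by blast
    qed
  qed
  then have "\<Union>(sphere_facets p q N W N) \<subseteq> A ` {..p} \<union> B ` {..q} \<union> V ` {..<N}" by blast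
  moreover have "A ` {..p} \<union> B ` {..q} \<subseteq> \<Union>(sphere_facets p q N W N)"
  proof -
    have "outer_facets p q \<subseteq> sphere_facets p q N W N" unfolding sphere_facets_def by blast
    then show ?thesis using Union_mono Union_outer_facets by metis
  qed
  moreover have "V l \<in> \<Union>(sphere_facets p q N W N)" if "l < N" for l
  proof -
    \<comment> \<open>No strip meets column 0, so the left side of the first compulsory square is a
      wall, and the cone over it contains \<open>V l\<close>.\<close>
    have "(0, 1 + 3 * l) \<notin> strip N l (W l)" "(Suc 0, 1 + 3 * l) \<in> strip N l (W l)"
      using W[of l] by (auto simp: strip_def)
    then have "insert (V l) (vertical_triangle 0 (1 + 3 * l)) \<in> boundary_cone (V l) (strip N l (W l))"
      unfolding cone_over_def vertical_boundary_def by blast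
    then have "insert (V l) (vertical_triangle 0 (1 + 3 * l)) \<in> sphere_facets p q N W N"
      using that unfolding sphere_facets_def by blast
    then show ?thesis by blast
  qed
  ultimately have "\<Union>(sphere_facets p q N W N) = A ` {..p} \<union> B ` {..q} \<union> V ` {..<N}"
    by (intro equalityI) (simp_all add: image_subset_iff)
  then show ?thesis by (simp add: vertices_faces)
qed

text \<open>The triangle is the left side of the optional square in column \<open>x\<close>. Its
  other neighbour lies on the diagonal \<open>3 * l + 3\<close>, outside the strip, so it is a wall
  exactly when the square was chosen. Only cone facets with apex \<open>V l\<close> can contain
  \<open>V l\<close>.\<close>

lemma choice_detected_by_faces:
  assumes W: "\<And>l. W l \<subseteq> {1..N}" and "l < N" "1 \<le> x"
  shows "insert (V l) (vertical_triangle (x - 1) (x + 3 * l + 2)) \<in> faces (sphere_facets p q N W N) \<longleftrightarrow> x \<in> W l"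
    (is "?T \<in> _ \<longleftrightarrow> _")
proof -
  obtain i where i: "x = Suc i" using assms by (cases x) auto
  have left: "(i, x + 3 * l + 2) \<notin> strip N l (W l)"
    using i by (auto simp: strip_def)
  have right: "(Suc i, x + 3 * l + 2) \<in> strip N l (W l) \<longleftrightarrow> x \<in> W l"
    using i by (auto simp: strip_def)
  show ?thesis
  proof
    assume "x \<in> W l"
    then have "?T \<in> boundary_cone (V l) (strip N l (W l))"
      using left right i unfolding cone_over_def vertical_boundary_def by auto
    then show "?T \<in> faces (sphere_facets p q N W N)"
      using \<open>l < N\<close> unfolding faces_def sphere_facets_def by blast
  next
    assume "?T \<in> faces (sphere_facets p q N W N)"
    then obtain G where G: "G \<in> sphere_facets p q N W N" "?T \<subseteq> G" unfolding faces_def by blast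
    then have "V l \<in> G" by blast
    moreover have "V l \<notin> tet a b" for a b by (simp add: tet_def)
    ultimately have "G \<notin> outer_facets p q" "G \<notin> tets Q" for Q
      using Union_outer_facets[of p q] unfolding tets_def by blast+
    then obtain l' where l': "G \<in> boundary_cone (V l') (strip N l' (W l'))"
      using G unfolding sphere_facets_def by blast
    then have "l' = l" using \<open>V l \<in> G\<close> by (auto simp: cone_over_def vertical_triangle_def horizontal_triangle_def)
    with l' obtain a b where
      "G = insert (V l) (vertical_triangle a b) \<and> (a, b) \<in> vertical_boundary (strip N l (W l)) \<or> G = insert (V l) (horizontal_triangle a b)"
      unfolding cone_over_def by auto
    then have "(i, x + 3 * l + 2) \<in> vertical_boundary (strip N l (W l))"
      using G(2) i by (auto simp: vertical_triangle_def horizontal_triangle_def)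
    then show "x \<in> W l" using left right unfolding vertical_boundary_def by blast
  qed
qed

subsection \<open>Counting isomorphism types\<close>

lemma homeomorphic_relabel:
  assumes f: "inj_on f U" and K: "\<And>S. S \<in> K \<Longrightarrow> S \<subseteq> U"
  shows "geometric_realization ((`) f ` K) homeomorphic geometric_realization K"
proof -
  define \<phi> where "\<phi> x = (\<lambda>w. if w \<in> f ` U then x (inv_into U f w) else 0)" for x :: "'a \<Rightarrow> real"
  define \<psi> where "\<psi> y = (\<lambda>v. if v \<in> U then y (f v) else 0)" for y :: "'b \<Rightarrow> real"
  have inv: "inv_into U f (f v) = v" if "v \<in> U" for v using f that by simp
  show ?thesis
    unfolding homeomorphic_minimal
  proof (intro exI[of _ \<psi>] exI[of _ \<phi>] conjI ballI)
    fix y assume y: "y \<in> geometric_realization ((`) f ` K)"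
    then obtain S where S: "S \<in> K" "{w. y w \<noteq> 0} = f ` S" and sum: "sum y (f ` S) = 1"
      and nonneg: "\<And>w. 0 \<le> y w"
      unfolding geometric_realization_def by auto
    have SU: "S \<subseteq> U" using K S by blast
    have supp: "{v. \<psi> y v \<noteq> 0} = S"
    proof -
      have "y (f v) \<noteq> 0 \<longleftrightarrow> f v \<in> f ` S" for v using S by blast
      moreover have "f v \<in> f ` S \<longleftrightarrow> v \<in> S" if "v \<in> U" for v
        using f that SU by (rule inj_on_image_mem_iff)
      ultimately show ?thesis using SU by (auto simp: \<psi>_def)
    qed
    have "sum (\<psi> y) S = (\<Sum>v\<in>S. y (f v))"
      by (rule sum.cong) (use SU in \<open>auto simp: \<psi>_def\<close>)
    also have "\<dots> = sum y (f ` S)"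
      using sum.reindex[OF inj_on_subset[OF f SU], of y] by simp
    finally show "\<psi> y \<in> geometric_realization K"
      using supp S sum nonneg by (simp add: geometric_realization_def) (simp add: \<psi>_def)
    show "\<phi> (\<psi> y) = y"
    proof
      fix w
      have "w \<notin> f ` U \<Longrightarrow> y w = 0" using S SU by blast
      then show "\<phi> (\<psi> y) w = y w" by (auto simp: \<phi>_def \<psi>_def inv)
    qed
  next
    fix x assume x: "x \<in> geometric_realization K"
    define S where "S = {v. x v \<noteq> 0}"
    have S: "S \<in> K" "sum x S = 1" and nonneg: "\<And>v. 0 \<le> x v"
      using x by (auto simp: geometric_realization_def S_def)
    have SU: "S \<subseteq> U" using K S by blast
    have \<phi>_f: "\<phi> x (f v) = x v" if "v \<in> U" for v using that inv by (simp add: \<phi>_def)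
    have "\<phi> x w \<noteq> 0 \<longleftrightarrow> w \<in> f ` S" for w
    proof
      assume w: "\<phi> x w \<noteq> 0"
      then obtain v where v: "v \<in> U" "w = f v" by (auto simp: \<phi>_def split: if_splits)
      then have "v \<in> S" using w \<phi>_f by (simp add: S_def)
      then show "w \<in> f ` S" using v by blast
    next
      assume "w \<in> f ` S"
      then obtain v where v: "v \<in> S" "w = f v" by blast
      then have "v \<in> U" using SU by blast
      then show "\<phi> x w \<noteq> 0" using v \<phi>_f by (simp add: S_def)
    qed
    then have supp: "{w. \<phi> x w \<noteq> 0} = f ` S" by blast
    have "sum (\<phi> x) (f ` S) = (\<Sum>v\<in>S. \<phi> x (f v))"
      using sum.reindex[OF inj_on_subset[OF f SU], of "\<phi> x"] by simp
    also have "\<dots> = sum x S"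
      by (rule sum.cong) (use SU \<phi>_f in auto)
    finally show "\<phi> x \<in> geometric_realization ((`) f ` K)"
      using supp S nonneg by (simp add: geometric_realization_def) (simp add: \<phi>_def)
    show "\<psi> (\<phi> x) = x"
    proof
      fix v
      have "v \<notin> U \<Longrightarrow> x v = 0" using SU by (auto simp: S_def)
      then show "\<psi> (\<phi> x) v = x v" by (auto simp: \<phi>_def \<psi>_def inv)
    qed
  next
    show "continuous_on (geometric_realization ((`) f ` K)) \<psi>"
    proof (rule continuous_on_coordinatewise_then_product)
      fix v show "continuous_on (geometric_realization ((`) f ` K)) (\<lambda>y. \<psi> y v)"
        unfolding \<psi>_def
        by (cases "v \<in> U") (auto intro: continuous_on_subset[OF continuous_on_product_coordinates])
    qed
    show "continuous_on (geometric_realization K) \<phi>"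
    proof (rule continuous_on_coordinatewise_then_product)
      fix w show "continuous_on (geometric_realization K) (\<lambda>x. \<phi> x w)"
        unfolding \<phi>_def
        by (cases "w \<in> f ` U") (auto intro: continuous_on_subset[OF continuous_on_product_coordinates])
    qed
  qed
qed

lemma simplicial_3_sphere_relabel:
  assumes K: "simplicial_3_sphere K" and f: "inj_on f (vertices K)"
  shows "simplicial_3_sphere ((`) f ` K)"
proof -
  have sub: "\<And>S. S \<in> K \<Longrightarrow> S \<subseteq> vertices K" unfolding vertices_def by blast
  have "T \<in> (`) f ` K" if S: "S \<in> K" and T: "T \<subseteq> f ` S" for S T
  proof -
    obtain S' where "S' \<subseteq> S" "T = f ` S'" using T by (metis subset_imageE)
    then show ?thesis
      using K S unfolding simplicial_3_sphere_def finite_simplicial_complex_def by blast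
  qed
  then have "finite_simplicial_complex ((`) f ` K)"
    using K unfolding simplicial_3_sphere_def finite_simplicial_complex_def by auto
  then show ?thesis
    using homeomorphic_relabel[OF f sub] K unfolding simplicial_3_sphere_def
    by (meson homeomorphic_trans)
qed

lemma card_labelled_3_spheres_ge:
  assumes n: "6 * N + 6 \<le> n" and N: "1 \<le> N"
  shows "2 ^ (N * N) \<le> card (labelled_3_spheres n)"
proof -
  \<comment> \<open>\<open>q\<close> is the smallest value with \<open>4 * N < q\<close>, and
    \<open>p\<close> absorbs the remaining vertices so that the total is \<open>n\<close>. The bound
    \<open>6 * N + 6 \<le> n\<close> is what makes \<open>p > N + 2\<close>.\<close>
  define q where "q = 4 * N + 1"
  define p where "p = n - 5 * N - 3"
  have pq: "N + 2 < p" "4 * N < q" "2 \<le> q" and npq: "p + 1 + (q + 1) + N = n"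
    using n N by (auto simp: p_def q_def)
  define U where "U = A ` {..p} \<union> B ` {..q} \<union> V ` {..<N}"
  have "card U = card (A ` {..p}) + card (B ` {..q}) + card (V ` {..<N})"
    unfolding U_def by (subst card_Un_disjoint; (subst card_Un_disjoint)?) auto
  also have "\<dots> = n" using npq by (simp add: card_image inj_on_def)
  finally have "card U = card {..<n}" by simp
  moreover have "finite U" by (simp add: U_def)
  ultimately obtain e where e: "bij_betw e U {..<n}"
    using finite_same_card_bij by blast
  \<comment> \<open>The \<open>N * N\<close> free choices, one for each strip and each optional
    square in it.\<close>
  define C where "C = {..<N} \<times> {1..N}"
  define W where "W S l = {x. (l, x) \<in> S}" for S :: "(nat \<times> nat) set" and l
  define K where "K S = faces (sphere_facets p q N (W S) N)" for S
  have WN: "W S l \<subseteq> {1..N}" if "S \<in> Pow C" for S l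
    using that by (auto simp: W_def C_def)
  have vert: "vertices (K S) = U" if "S \<in> Pow C" for S
    unfolding K_def U_def by (rule vertices_sphere_facets) (use pq WN[OF that] in auto)
  have sphere: "simplicial_3_sphere (K S)" if "S \<in> Pow C" for S
    using is_sphere_sphere_facets[OF pq WN[OF that], of N] by (simp add: K_def is_sphere_def)
  have "inj_on K (Pow C)"
  proof (rule inj_onI)
    fix S S' assume S: "S \<in> Pow C" "S' \<in> Pow C" and eq: "K S = K S'"
    have "(l, x) \<in> S \<longleftrightarrow> (l, x) \<in> S'" if "(l, x) \<in> C" for l x
      using choice_detected_by_faces[where W = "W S", OF WN[OF S(1)], of l x p q]
        choice_detected_by_faces[where W = "W S'", OF WN[OF S(2)], of l x p q] that eq
      by (simp add: K_def C_def W_def)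
    then show "S = S'" using S by auto
  qed
  moreover have "inj_on ((`) ((`) e)) (K ` Pow C)"
  proof (rule inj_on_subset)
    show "inj_on ((`) ((`) e)) (Pow (Pow U))"
      using e by (intro inj_on_image_Pow) (simp add: bij_betw_def)
    show "K ` Pow C \<subseteq> Pow (Pow U)" using vert unfolding vertices_def by blast
  qed
  ultimately have inj: "inj_on ((`) ((`) e) \<circ> K) (Pow C)" by (rule comp_inj_on)
  have "((`) ((`) e) \<circ> K) ` Pow C \<subseteq> labelled_3_spheres n"
  proof
    fix L assume "L \<in> ((`) ((`) e) \<circ> K) ` Pow C"
    then obtain S where S: "S \<in> Pow C" "L = (`) e ` K S" by auto
    have "inj_on e (vertices (K S))" using vert[OF S(1)] e by (simp add: bij_betw_def)
    then have "simplicial_3_sphere L"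
      unfolding S(2) by (rule simplicial_3_sphere_relabel[OF sphere[OF S(1)]])
    moreover have "vertices L = e ` vertices (K S)"
      unfolding S(2) vertices_def by blast
    then have "vertices L = {..<n}" using vert[OF S(1)] e by (simp add: bij_betw_def)
    ultimately show "L \<in> labelled_3_spheres n" by (simp add: labelled_3_spheres_def)
  qed
  then have "card (((`) ((`) e) \<circ> K) ` Pow C) \<le> card (labelled_3_spheres n)"
    by (rule card_mono[OF finite_labelled_3_spheres])
  then show ?thesis
    using card_image[OF inj] by (simp add: card_Pow C_def)
qed

text \<open>Each member of the class is the image of \<open>K\<close> under a self-map of the vertex
  set; counting all self-maps gives the crude bound \<open>n ^ n\<close>.\<close>

lemma card_same_type_class_le:
  assumes "K \<in> labelled_3_spheres n"
  shows "card (same_type n `` {K}) \<le> n ^ n"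
proof -
  define P where "P = {..<n} \<rightarrow>\<^sub>E {..<n}"
  have P: "finite P" "card P = n ^ n"
    by (auto simp: P_def card_PiE intro!: finite_PiE)
  have vK: "vertices K = {..<n}" using assms by (simp add: labelled_3_spheres_def)
  have "L \<in> (\<lambda>f. (`) f ` K) ` P" if KL: "(K, L) \<in> same_type n" for L
  proof -
    have vL: "vertices L = {..<n}" using KL by (simp add: same_type_def labelled_3_spheres_def)
    obtain f where f: "bij_betw f {..<n} {..<n}"
      and faces_iff: "\<And>S. S \<subseteq> {..<n} \<Longrightarrow> S \<in> K \<longleftrightarrow> f ` S \<in> L"
      using KL vK vL unfolding same_type_def combinatorially_isomorphic_def by auto
    \<comment> \<open>Restriction makes the bijection a member of the finite set
      \<open>P\<close>.\<close>
    define g where "g = restrict f {..<n}"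
    have "g \<in> P" using f unfolding g_def P_def by (auto simp: bij_betw_def)
    have gS: "g ` S = f ` S" if "S \<subseteq> {..<n}" for S using that by (auto simp: g_def)
    have subK: "\<And>S. S \<in> K \<Longrightarrow> S \<subseteq> {..<n}" using vK unfolding vertices_def by blast
    have "L = (`) g ` K"
    proof (intro equalityI subsetI)
      fix T assume T: "T \<in> L"
      then have "T \<subseteq> f ` {..<n}" using vL f unfolding vertices_def bij_betw_def by blast
      then obtain S where S: "S \<subseteq> {..<n}" "T = f ` S" by (metis subset_imageE)
      then have "S \<in> K" using faces_iff T by blast
      then show "T \<in> (`) g ` K" using gS[OF S(1)] S(2) by blast
    next
      fix T assume "T \<in> (`) g ` K"
      then obtain S where "S \<in> K" "T = g ` S" by blast
      then show "T \<in> L" using faces_iff[OF subK] gS[OF subK] by simp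
    qed
    then show ?thesis using \<open>g \<in> P\<close> by blast
  qed
  then have "same_type n `` {K} \<subseteq> (\<lambda>f. (`) f ` K) ` P" by blast
  then have "card (same_type n `` {K}) \<le> card ((\<lambda>f. (`) f ` K) ` P)"
    by (rule card_mono[OF finite_imageI[OF P(1)]])
  also have "\<dots> \<le> n ^ n" using card_image_le[OF P(1)] P(2) by metis
  finally show ?thesis .
qed

lemma card_labelled_3_spheres_le: "card (labelled_3_spheres n) \<le> num_3_spheres n * n ^ n"
proof -
  let ?Q = "labelled_3_spheres n // same_type n"
  have "card (labelled_3_spheres n) = card (\<Union>?Q)"
    using Union_quotient[OF equiv_same_type] by simp
  also have "\<dots> \<le> sum card ?Q" by (rule card_Union_le_sum_card)
  also have "\<dots> \<le> card ?Q * n ^ n"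
    using sum_bounded_above[of ?Q card "n ^ n"] card_same_type_class_le by (auto elim!: quotientE)
  finally show ?thesis by (simp add: num_3_spheres_def)
qed

text \<open>The choices contribute a quadratic exponent, while the relabellings cost only
  \<open>n * log 2 n\<close>; the difference outgrows every power of \<open>n\<close> below the
  second.\<close>

lemma eventually_exponent_bound:
  "eventually (\<lambda>n. real n powr (5/4) \<le> (real n / 6 - 2)\<^sup>2 - real n * log 2 (real n)) at_top"
  by real_asymp

theorem theorem1:
  "\<exists>c::real. c > 0 \<and>
     (\<exists>N::nat. \<forall>n\<ge>N. real (num_3_spheres n) \<ge> 2 powr (c * real n powr (5/4)))"
proof -
  obtain n0 where n0: "\<And>n. n \<ge> n0 \<Longrightarrow>
      real n powr (5/4) \<le> (real n / 6 - 2)\<^sup>2 - real n * log 2 (real n)"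
    using eventually_exponent_bound unfolding eventually_at_top_linorder by blast
  have "2 powr (1 * real n powr (5/4)) \<le> real (num_3_spheres n)" if n: "n \<ge> max n0 12" for n
  proof -
    \<comment> \<open>The largest \<open>N\<close> with \<open>6 * N + 6 \<le> n\<close>;
      \<open>n \<ge> 12\<close> gives \<open>N \<ge> 1\<close>, and rounding down loses less than 2
      compared with \<open>n / 6\<close>.\<close>
    define N where "N = n div 6 - 1"
    have N: "6 * N + 6 \<le> n" "1 \<le> N" "n < 6 * N + 12" using n by (auto simp: N_def)
    have "real n / 6 - 2 \<le> real N" using N(3) by simp
    moreover have "0 \<le> real n / 6 - 2" using n by simp
    ultimately have "(real n / 6 - 2)\<^sup>2 \<le> (real N)\<^sup>2" by (rule power_mono)
    then have exponent: "real n powr (5/4) \<le> real (N * N) - real n * log 2 (real n)"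
      using n0[of n] n by (simp add: power2_eq_square)
    have "(2::nat) ^ (N * N) \<le> num_3_spheres n * n ^ n"
      using card_labelled_3_spheres_ge[OF N(1,2)] card_labelled_3_spheres_le by (rule order_trans)
    then have "real (2 ^ (N * N)) \<le> real (num_3_spheres n * n ^ n)"
      by (simp only: of_nat_le_iff)
    then have "2 powr real (N * N) \<le> real (num_3_spheres n) * real n ^ n"
      using powr_realpow[of 2 "N * N"] by simp
    moreover have pow: "real n ^ n = 2 powr (real n * log 2 (real n))"
      using n by (simp add: powr_realpow[symmetric] powr_powr[symmetric] mult.commute[of "real n"])
    ultimately have "2 powr (real (N * N) - real n * log 2 (real n)) \<le> real (num_3_spheres n)"
      by (simp add: powr_diff divide_le_eq)
    moreover have "2 powr (1 * real n powr (5/4)) \<le> 2 powr (real (N * N) - real n * log 2 (real n))"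
      using exponent by simp
    ultimately show ?thesis by (rule order_trans[rotated])
  qed
  then show ?thesis by (intro exI[of _ 1] conjI exI[of _ "max n0 12"] allI impI) auto
qed

end
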